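(* Let $q=p^t$ with $p$ prime, let $n\ge 3$ and $1\le r\le n-2$. Let $A_1$ be the $(0,1)$ incidence matrix between the $r$-flats (rows) and points (columns) of the affine space $\mathrm{AG}(n,q)=\mathbb{F}_q^n$, the $(Y,Z)$-entry being $1$ iff $Z\in Y$. Then the $p$-adic invariant factors of $A_1$ (its invariant factors over $\mathbb{Z}_p$, up to units) are $p^\alpha$, $0\le\alpha\le rt$, where $p^\alpha$ occurs with multiplicity $m(\alpha,n,r+1)-m(\alpha,n-1,r+1)$.
   Context: For integers $N\ge2$, $1<i\le N$ and $\alpha\ge0$, $m(\alpha,N,i)$ denotes the multiplicity of $p^\alpha$ among the $p$-adic invariant factors (invariant factors over $\mathbb{Z}_p$) of the $(0,1)$ incidence matrix whose rows are indexed by the $i$-dimensional subspaces of $\mathbb{F}_q^{N+1}$ (projective $(i-1)$-spaces of $\mathrm{PG}(N,q)$), whose columns are indexed by the $1$-dimensional subspaces (points), with entry $1$ iff the point is contained in the subspace. *)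

theory Defs
  imports
    "Berlekamp_Zassenhaus.Finite_Field"
    "Jordan_Normal_Form.VS_Connect"
begin

text \<open>
  The ring of \<open>p\<close>-adic integers as the inverse limit of the rings \<open>\<int>/p\<^sup>k\<int>\<close>: the sequences
  \<open>x\<close> with \<open>x k \<in> {0..<p\<^sup>k}\<close> that are compatible with reduction.  The prime is carried by
  the type parameter, \<open>p = CARD('p)\<close>; class \<open>prime_card\<close> says that this number is prime.
\<close>

typedef (overloaded) ('p :: prime_card) padic_int =
  "{x :: nat \<Rightarrow> int. \<forall>k. x k \<in> {0..<int CARD('p) ^ k} \<and> x (Suc k) mod int CARD('p) ^ k = x k}"
  by (rule exI[of _ "\<lambda>_. 0"]) (simp add: prime_gt_0_nat[OF prime_card])

setup_lifting type_definition_padic_int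

lemma padic_closed:
  fixes f :: "nat \<Rightarrow> int"
  assumes "f (Suc k) mod int CARD('p :: prime_card) ^ k = f k mod int CARD('p) ^ k"
  shows "f k mod int CARD('p) ^ k \<in> {0..<int CARD('p) ^ k} \<and>
         f (Suc k) mod int CARD('p) ^ Suc k mod int CARD('p) ^ k = f k mod int CARD('p) ^ k"
  by (simp add: assms mod_mod_cancel prime_gt_0_nat[OF prime_card])

instantiation padic_int :: (prime_card) comm_ring_1
begin

lift_definition zero_padic_int :: "'a padic_int" is "\<lambda>k. 0"
  by (simp add: prime_gt_0_nat[OF prime_card])

lift_definition one_padic_int :: "'a padic_int" is "\<lambda>k. 1 mod int CARD('a) ^ k"
  by (rule padic_closed) simp

lift_definition plus_padic_int :: "'a padic_int \<Rightarrow> 'a padic_int \<Rightarrow> 'a padic_int"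
  is "\<lambda>x y k. (x k + y k) mod int CARD('a) ^ k"
  by (rule padic_closed) (metis mod_add_eq)

lift_definition minus_padic_int :: "'a padic_int \<Rightarrow> 'a padic_int \<Rightarrow> 'a padic_int"
  is "\<lambda>x y k. (x k - y k) mod int CARD('a) ^ k"
  by (rule padic_closed) (metis mod_diff_eq)

lift_definition uminus_padic_int :: "'a padic_int \<Rightarrow> 'a padic_int"
  is "\<lambda>x k. (- x k) mod int CARD('a) ^ k"
  by (rule padic_closed) (metis mod_minus_eq)

lift_definition times_padic_int :: "'a padic_int \<Rightarrow> 'a padic_int \<Rightarrow> 'a padic_int"
  is "\<lambda>x y k. (x k * y k) mod int CARD('a) ^ k"
  by (rule padic_closed) (metis mod_mult_eq)

instance
proof
  fix a b c :: "'a padic_int"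
  show "a * b * c = a * (b * c)"
    by transfer (simp add: mod_mult_left_eq mod_mult_right_eq mult.assoc)
  show "a * b = b * a"
    by transfer (simp add: mult.commute)
  show "1 * a = a"
    by transfer (auto simp: mod_mult_left_eq)
  show "a + b + c = a + (b + c)"
    by transfer (simp add: mod_add_left_eq mod_add_right_eq add.assoc)
  show "a + b = b + a"
    by transfer (simp add: add.commute)
  show "0 + a = a"
    by transfer auto
  show "- a + a = 0"
    by transfer (simp add: mod_add_left_eq)
  show "a - b = a + - b"
    by transfer (simp add: mod_add_right_eq)
  show "(a + b) * c = a * c + b * c"
    by transfer (simp add: mod_mult_left_eq mod_add_eq distrib_right)
  show "(0 :: 'a padic_int) \<noteq> 1"
  proof transfer
    have "1 mod int CARD('a) ^ 1 = 1"
      using prime_gt_1_nat[OF prime_card[where ?'a = 'a]] by simp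
    then show "(\<lambda>k. 0) \<noteq> (\<lambda>k. 1 mod int CARD('a) ^ k)"
      by (metis zero_neq_one)
  qed
qed

end

text \<open>
  \<open>ds\<close> is the diagonal of a Smith normal form of \<open>A\<close>.  It has length \<open>min (dim_row A) (dim_col A)\<close>,
  so a rank-deficient matrix has trailing entries \<open>0\<close>.
\<close>

definition smith_diagonal :: "'r :: comm_ring_1 mat \<Rightarrow> 'r list \<Rightarrow> bool" where
  "smith_diagonal A ds \<longleftrightarrow>
     (\<exists>P Q D. P \<in> carrier_mat (dim_row A) (dim_row A) \<and> invertible_mat P \<and>
              Q \<in> carrier_mat (dim_col A) (dim_col A) \<and> invertible_mat Q \<and>
              D = P * A * Q \<and> diagonal_mat D \<and>
              ds = map (\<lambda>i. D $$ (i, i)) [0..<min (dim_row A) (dim_col A)] \<and>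
              sorted_wrt (dvd) ds)"

text \<open>
  The choice is only determined up to unit factors, which is why multiplicities are
  counted modulo units.  Over a ring such as \<open>\<int>\<^sub>p\<close> every matrix has a Smith normal form.
\<close>

definition invariant_factors :: "'r :: comm_ring_1 mat \<Rightarrow> 'r list" where
  "invariant_factors A = (SOME ds. smith_diagonal A ds)"

definition eq_up_to_unit :: "'r :: comm_ring_1 \<Rightarrow> 'r \<Rightarrow> bool" where
  "eq_up_to_unit d c \<longleftrightarrow> (\<exists>u. u dvd 1 \<and> d = u * c)"

definition invariant_factor_mult :: "'r :: comm_ring_1 \<Rightarrow> 'r mat \<Rightarrow> nat" where
  "invariant_factor_mult c A = length (filter (\<lambda>d. eq_up_to_unit d c) (invariant_factors A))"

definition incidence_mat :: "('y \<Rightarrow> 'z \<Rightarrow> bool) \<Rightarrow> 'y list \<Rightarrow> 'z list \<Rightarrow> 'r :: comm_ring_1 mat" where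
  "incidence_mat inc Ys Zs =
     mat (length Ys) (length Zs) (\<lambda>(i, j). if inc (Ys ! i) (Zs ! j) then 1 else 0)"

text \<open>The \<open>k\<close>-dimensional linear subspaces of \<open>F\<^sup>d\<close>.\<close>

definition subspaces :: "nat \<Rightarrow> nat \<Rightarrow> 'q :: field vec set set" where
  "subspaces d k =
     {W. subspace class_ring W (module_vec TYPE('q) d) \<and>
         vectorspace.dim class_ring ((module_vec TYPE('q) d)\<lparr>carrier := W\<rparr>) = k}"

definition flats :: "nat \<Rightarrow> nat \<Rightarrow> 'q :: field vec set set" where
  "flats d k = {(\<lambda>w. v + w) ` W | v W. v \<in> carrier_vec d \<and> W \<in> subspaces d k}"

text \<open>
  \<open>m(\<alpha>, N, i)\<close> for \<open>F\<^sub>q = 'q\<close> and \<open>\<int>\<^sub>p = 'p padic_int\<close>.  The orderings of rows and columns are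
  irrelevant, since permuting them does not change the invariant factors.
\<close>

definition proj_mult ::
    "'p :: prime_card itself \<Rightarrow> 'q :: {field, finite} itself \<Rightarrow> nat \<Rightarrow> nat \<Rightarrow> nat \<Rightarrow> nat" where
  "proj_mult _ _ \<alpha> N i =
     (let Ys = (SOME Ys. distinct Ys \<and> set Ys = (subspaces (N + 1) i :: 'q vec set set));
          Zs = (SOME Zs. distinct Zs \<and> set Zs = (subspaces (N + 1) 1 :: 'q vec set set))
      in invariant_factor_mult (of_nat CARD('p) ^ \<alpha>)
           (incidence_mat (\<lambda>Y Z. Z \<subseteq> Y) Ys Zs :: 'p padic_int mat))"

end

theory Submission
  imports Defs
begin

text \<open>
  Embed \<open>AG(n,q)\<close> in \<open>PG(n,q)\<close> and list first the subspaces and points that are not at infinity.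
  The incidence matrix of \<open>PG(n,q)\<close> becomes the block matrix with rows \<open>(A\<^sub>1, B)\<close> and \<open>(0, A\<^sub>2)\<close>, where
  \<open>A\<^sub>2\<close> is the incidence matrix of the hyperplane at infinity and \<open>B\<close> records which points at
  infinity lie in the direction of a flat.  It turns out that \<open>B = A\<^sub>1 X + T A\<^sub>2\<close> for explicit
  matrices \<open>X\<close> and \<open>T\<close> over \<open>\<int>\<^sub>p\<close>, so that row and column operations remove \<open>B\<close> and the invariant factors
  of \<open>PG(n,q)\<close> are those of \<open>A\<^sub>1\<close> together with those of \<open>A\<^sub>2\<close>.  The only denominator in \<open>X\<close> and \<open>T\<close> is
  \<open>1 + q + \<dots> + q\<^bsup>n-r-2\<^esup>\<close>, which is a \<open>p\<close>-adic unit because \<open>r \<le> n - 2\<close>.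

  The bound \<open>\<alpha> \<le> rt\<close> holds because \<open>q\<^sup>r\<close> times a point is an integral combination of \<open>r\<close>-flats, so
  that \<open>C A\<^sub>1 = q\<^sup>r I\<close> for some \<open>C\<close>.
\<close>

section \<open>The \<open>p\<close>-adic integers as a discrete valuation ring\<close>

text \<open>\<open>X\<close> and \<open>T\<close> come from comparing two counts attached to an
  \<open>r\<close>-flat \<open>F\<close> and a line \<open>L\<close> through the origin, which
  stands for a point at infinity: the number of vectors common to \<open>F\<close> and
  \<open>L\<close>, and the number of \<open>(r+1)\<close>-dimensional subspaces containing both.
  The first is an entry of \<open>A\<^sub>1\<close> times an incidence matrix, the second an entry
  of an incidence matrix times \<open>A\<^sub>2\<close>. If \<open>F\<close> misses the origin, the
  second count minus the first is already the entry of \<open>B\<close>. If \<open>F\<close>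
  contains it, the counts are \<open>1\<close> and \<open>1\<close> for \<open>L\<close> outside
  \<open>F\<close>, but \<open>q\<close> and \<open>1 + q s\<close> for \<open>L\<close> inside
  \<open>F\<close>, where \<open>s = 1 + q + ... + q^(n-r-2)\<close>. Weighting the second count by
  the inverse of \<open>s\<close> and adding a correction at the origin gives \<open>B\<close> here
  too.

  The invariant factors are defined by a choice of Smith form, so reading off multiplicities needs a
  quantity common to all equivalent forms. It is the number of entries not divisible by
  \<open>p^k\<close>, taken in any equivalent matrix with at most one nonzero entry in each row and
  column; it is additive over diagonal blocks.\<close>

lift_definition padic_comp :: "'p::prime_card padic_int \<Rightarrow> nat \<Rightarrow> int" is "\<lambda>x. x" .

lemma padic_eqI: "(\<And>k. padic_comp x k = padic_comp y k) \<Longrightarrow> x = y"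
  by transfer auto

lemma padic_comp_range:
  fixes x :: "'p::prime_card padic_int"
  shows "padic_comp x k \<in> {0..<int CARD('p) ^ k}"
  by transfer auto

lemma padic_comp_mod:
  fixes x :: "'p::prime_card padic_int"
  assumes "j \<le> k"
  shows "padic_comp x k mod int CARD('p) ^ j = padic_comp x j"
  using assms
proof (induction k rule: dec_induct)
  case base
  then show ?case using padic_comp_range[of x j] by simp
next
  case (step k)
  have "padic_comp x (Suc k) mod int CARD('p) ^ k = padic_comp x k"
    by transfer auto
  then have "padic_comp x (Suc k) mod int CARD('p) ^ k mod int CARD('p) ^ j = padic_comp x j"
    using step by simp
  moreover have "int CARD('p) ^ j dvd int CARD('p) ^ k"
    using step by (simp add: le_imp_power_dvd)
  ultimately show ?case by (simp add: mod_mod_cancel)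
qed

lemma padic_comp_add:
  "padic_comp (x + y :: 'p::prime_card padic_int) k = (padic_comp x k + padic_comp y k) mod int CARD('p) ^ k"
  by transfer simp

lemma padic_comp_mult:
  "padic_comp (x * y :: 'p::prime_card padic_int) k = (padic_comp x k * padic_comp y k) mod int CARD('p) ^ k"
  by transfer simp

lemma padic_comp_0 [simp]: "padic_comp 0 k = 0"
  by transfer simp

lemma padic_comp_1: "padic_comp (1 :: 'p::prime_card padic_int) k = 1 mod int CARD('p) ^ k"
  by transfer simp

lemma padic_comp_of_nat:
  "padic_comp (of_nat m :: 'p::prime_card padic_int) k = int m mod int CARD('p) ^ k"
  by (induction m) (simp_all add: padic_comp_add padic_comp_1 mod_add_eq)

text \<open>Inverses and quotients are built below one residue at a time; this assembles the
  residues into an element.\<close>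

lemma padic_of_seq:
  fixes f :: "nat \<Rightarrow> int"
  assumes "\<And>k. f k \<in> {0..<int CARD('p) ^ k}" "\<And>k. f (Suc k) mod int CARD('p) ^ k = f k"
  obtains x :: "'p::prime_card padic_int" where "\<And>k. padic_comp x k = f k"
proof -
  have "\<exists>x :: 'p padic_int. \<forall>k. padic_comp x k = f k"
    using assms
  proof transfer
    fix f :: "nat \<Rightarrow> int"
    assume "\<And>k. f k \<in> {0..<int CARD('p) ^ k}" "\<And>k. f (Suc k) mod int CARD('p) ^ k = f k"
    then show "\<exists>x\<in>{x. \<forall>k. x k \<in> {0..<int CARD('p) ^ k} \<and> x (Suc k) mod int CARD('p) ^ k = x k}.
       \<forall>k. x k = f k" by auto
  qed
  then show thesis using that by blast
qed

text \<open>A nonzero residue modulo \<open>p\<close> makes every residue of \<open>x\<close>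
  coprime to \<open>p^k\<close>. Inverses modulo \<open>p^k\<close> are unique, so they fit together
  into a \<open>p\<close>-adic integer.\<close>

lemma padic_unit_iff:
  fixes x :: "'p::prime_card padic_int"
  shows "x dvd 1 \<longleftrightarrow> padic_comp x 1 \<noteq> 0"
proof
  assume "x dvd 1"
  then obtain y where y: "1 = x * y" by auto
  have "padic_comp (x * y) 1 = 1 mod int CARD('p)"
    unfolding y[symmetric] by (simp add: padic_comp_1)
  also have "\<dots> = 1" using prime_gt_1_nat[OF prime_card[where ?'a = 'p]] by simp
  finally show "padic_comp x 1 \<noteq> 0" by (auto simp: padic_comp_mult)
next
  assume x: "padic_comp x 1 \<noteq> 0"
  let ?p = "int CARD('p)"
  have p: "prime ?p" using prime_card[where ?'a = 'p] by simp
  have "padic_comp x k mod ?p \<noteq> 0" if "k > 0" for k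
    using padic_comp_mod[of 1 k x] x that by simp
  then have "coprime (padic_comp x k) ?p" if "k > 0" for k
    using p that by (simp add: coprime_commute mod_eq_0_iff_dvd prime_imp_coprime)
  then have cop: "coprime (padic_comp x k) (?p ^ k)" for k
    by (cases "k = 0") auto
  \<comment> \<open>Reducing the chosen inverse modulo \<open>p^k\<close> makes it canonical, so
    that compatibility of consecutive terms can be an equality.\<close>
  define f where "f k = (SOME y. [padic_comp x k * y = 1] (mod ?p ^ k)) mod ?p ^ k" for k
  have f: "[padic_comp x k * f k = 1] (mod ?p ^ k)" for k
    unfolding f_def using someI_ex[OF cong_solve_coprime_int[OF cop[of k]]]
    by (simp add: cong_def mod_mult_right_eq)
  have f_range: "f k \<in> {0..<?p ^ k}" for k
    unfolding f_def using p by (simp add: prime_gt_0_int)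
  have "f (Suc k) mod ?p ^ k = f k" for k
  proof -
    have "[padic_comp x (Suc k) * f (Suc k) = 1] (mod ?p ^ k)"
      by (rule cong_dvd_modulus[OF f]) simp
    moreover have "[padic_comp x (Suc k) = padic_comp x k] (mod ?p ^ k)"
      using padic_comp_mod[of k "Suc k" x] padic_comp_mod[of k k x] by (simp add: cong_def)
    ultimately have "[padic_comp x k * f (Suc k) = 1] (mod ?p ^ k)"
      by (meson cong_scalar_right cong_sym cong_trans)
    then have "[padic_comp x k * f (Suc k) = padic_comp x k * f k] (mod ?p ^ k)"
      using f[of k] by (meson cong_sym cong_trans)
    then have "[f (Suc k) = f k] (mod ?p ^ k)"
      using cop[of k] by (simp add: cong_mult_lcancel)
    then show ?thesis using f_range[of k] by (simp add: cong_def)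
  qed
  with f_range obtain y :: "'p padic_int" where y: "\<And>k. padic_comp y k = f k"
    using padic_of_seq by blast
  have "x * y = 1"
    by (rule padic_eqI) (use f in \<open>auto simp: padic_comp_mult padic_comp_1 y cong_def\<close>)
  then show "x dvd 1" by (metis dvd_triv_left)
qed

text \<open>The residue of \<open>x / p^v\<close> modulo \<open>p^k\<close> needs \<open>x\<close>
  modulo \<open>p^(k+v)\<close>, hence the shifted index. The formula for the components of the
  quotient is exported because \<open>padic_decompose\<close> tests the first of them.\<close>

lemma padic_power_dvd:
  fixes x :: "'p::prime_card padic_int"
  assumes "padic_comp x v = 0"
  obtains y where "x = y * of_nat CARD('p) ^ v" "\<And>k. padic_comp y k = padic_comp x (k + v) div int CARD('p) ^ v"
proof -
  let ?p = "int CARD('p)"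
  have p: "?p > 0" using prime_gt_0_nat[OF prime_card[where ?'a = 'p]] by simp
  define f where "f k = padic_comp x (k + v) div ?p ^ v" for k
  have "padic_comp x (k + v) mod ?p ^ v = 0" for k
    using padic_comp_mod[of v "k + v" x] assms by simp
  then have f: "padic_comp x (k + v) = f k * ?p ^ v" for k
    unfolding f_def by (metis dvd_div_mult_self mod_eq_0_iff_dvd)
  have 1: "f k \<in> {0..<?p ^ k}" for k
  proof -
    have "f k * ?p ^ v < ?p ^ k * ?p ^ v" "0 \<le> f k * ?p ^ v"
      using padic_comp_range[of x "k + v"] by (auto simp: f power_add)
    moreover have "?p ^ v > 0" using p by simp
    ultimately show ?thesis by (simp add: zero_le_mult_iff)
  qed
  have 2: "f (Suc k) mod ?p ^ k = f k" for k
  proof -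
    have "f k * ?p ^ v = padic_comp x (Suc k + v) mod ?p ^ (k + v)"
      using padic_comp_mod[of "k + v" "Suc k + v" x] f[of k] by simp
    also have "\<dots> = (f (Suc k) * ?p ^ v) mod (?p ^ k * ?p ^ v)"
      using f[of "Suc k"] by (simp add: power_add)
    also have "\<dots> = (f (Suc k) mod ?p ^ k) * ?p ^ v"
      by (simp add: mult_mod_left)
    finally show ?thesis using p by simp
  qed
  obtain y :: "'p padic_int" where y: "\<And>k. padic_comp y k = f k"
    using padic_of_seq[OF 1 2] by blast
  have "x = y * of_nat CARD('p) ^ v"
  proof (rule padic_eqI)
    fix k
    have "padic_comp (of_nat CARD('p) ^ v :: 'p padic_int) k = ?p ^ v mod ?p ^ k"
      using padic_comp_of_nat[of "CARD('p) ^ v" k, where ?'p = 'p] by simp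
    then have "padic_comp (y * of_nat CARD('p) ^ v) k = (f k * ?p ^ v) mod ?p ^ k"
      by (simp add: padic_comp_mult y mod_mult_right_eq)
    also have "\<dots> = padic_comp x k"
      using padic_comp_mod[of k "k + v" x] by (simp add: f)
    finally show "padic_comp x k = padic_comp (y * of_nat CARD('p) ^ v) k" ..
  qed
  then show thesis using that y unfolding f_def by blast
qed

lemma padic_p_not_unit: "\<not> (of_nat CARD('p) :: 'p::prime_card padic_int) dvd 1"
  by (simp add: padic_unit_iff padic_comp_of_nat)

lemma padic_p_power_nonzero: "(of_nat CARD('p) :: 'p::prime_card padic_int) ^ k \<noteq> 0"
proof
  assume "(of_nat CARD('p) :: 'p::prime_card padic_int) ^ k = 0"
  then have "padic_comp (of_nat (CARD('p) ^ k) :: 'p padic_int) (Suc k) = 0" by simp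
  then have "int CARD('p) ^ k mod int CARD('p) ^ Suc k = 0"
    unfolding padic_comp_of_nat by simp
  moreover have "int CARD('p) > 1" using prime_gt_1_nat[OF prime_card[where ?'a = 'p]] by simp
  ultimately show False by simp
qed

text \<open>The valuation is the last level \<open>v\<close> at which the residue of
  \<open>x\<close> vanishes; level \<open>0\<close> always qualifies since \<open>p^0 = 1\<close>.
  The residue of \<open>x / p^v\<close> modulo \<open>p\<close> is then nonzero, so this quotient is
  a unit.\<close>

lemma padic_decompose:
  fixes x :: "'p::prime_card padic_int"
  assumes "x \<noteq> 0"
  shows "\<exists>u k. u dvd 1 \<and> x = u * of_nat CARD('p) ^ k"
proof -
  let ?p = "int CARD('p)"
  have "\<exists>k. padic_comp x k \<noteq> 0"
    using assms padic_eqI[of x 0] by auto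
  moreover have "padic_comp x 0 = 0" using padic_comp_range[of x 0] by simp
  ultimately obtain v where v: "padic_comp x v = 0" "padic_comp x (Suc v) \<noteq> 0"
    using dec_induct[of 0 _ "\<lambda>k. padic_comp x k = 0"] by blast
  obtain y where y: "x = y * of_nat CARD('p) ^ v" "\<And>k. padic_comp y k = padic_comp x (k + v) div ?p ^ v"
    using padic_power_dvd[OF v(1)] by blast
  have "padic_comp x (Suc v) mod ?p ^ v = 0"
    using padic_comp_mod[of v "Suc v" x] v by simp
  then have "padic_comp y 1 \<noteq> 0"
    using v y(2)[of 1] by (simp add: mod_eq_0_iff_dvd dvd_div_eq_0_iff)
  then show ?thesis using y padic_unit_iff by blast
qed

section \<open>Equivalence of matrices\<close>

text \<open>The inverses are explicit witnesses with fixed dimensions, so that symmetry just swaps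
  them and inverses of block matrices can be written down.\<close>

definition mat_equiv :: "'r :: comm_ring_1 mat \<Rightarrow> 'r mat \<Rightarrow> bool" where
  "mat_equiv A B \<longleftrightarrow>
     (\<exists>P P' Q Q'. P \<in> carrier_mat (dim_row A) (dim_row A) \<and> P' \<in> carrier_mat (dim_row A) (dim_row A) \<and>
        Q \<in> carrier_mat (dim_col A) (dim_col A) \<and> Q' \<in> carrier_mat (dim_col A) (dim_col A) \<and>
        P * P' = 1\<^sub>m (dim_row A) \<and> P' * P = 1\<^sub>m (dim_row A) \<and>
        Q * Q' = 1\<^sub>m (dim_col A) \<and> Q' * Q = 1\<^sub>m (dim_col A) \<and> B = P * A * Q)"

lemma mat_equivI:
  assumes "A \<in> carrier_mat m n" "P \<in> carrier_mat m m" "P' \<in> carrier_mat m m"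
    "Q \<in> carrier_mat n n" "Q' \<in> carrier_mat n n"
    "P * P' = 1\<^sub>m m" "P' * P = 1\<^sub>m m" "Q * Q' = 1\<^sub>m n" "Q' * Q = 1\<^sub>m n" "B = P * A * Q"
  shows "mat_equiv A B"
  using assms unfolding mat_equiv_def by (metis carrier_matD)

lemma mat_equivE:
  assumes "mat_equiv A B" "A \<in> carrier_mat m n"
  obtains P P' Q Q' where "P \<in> carrier_mat m m" "P' \<in> carrier_mat m m"
    "Q \<in> carrier_mat n n" "Q' \<in> carrier_mat n n"
    "P * P' = 1\<^sub>m m" "P' * P = 1\<^sub>m m" "Q * Q' = 1\<^sub>m n" "Q' * Q = 1\<^sub>m n" "B = P * A * Q"
  using assms unfolding mat_equiv_def by (metis carrier_matD)

lemma mat_equiv_carrier: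
  assumes "mat_equiv A B" "A \<in> carrier_mat m n"
  shows "B \<in> carrier_mat m n"
  using mat_equivE[OF assms] assms(2) by (metis mult_carrier_mat)

lemma mat_equiv_refl: "mat_equiv A A"
  by (rule mat_equivI[of A "dim_row A" "dim_col A" "1\<^sub>m _" "1\<^sub>m _" "1\<^sub>m _" "1\<^sub>m _"]) auto

lemma mat_equiv_sym:
  assumes "mat_equiv A B"
  shows "mat_equiv B A"
proof -
  obtain m n where A: "A \<in> carrier_mat m n" by blast
  obtain P P' Q Q' where *: "P \<in> carrier_mat m m" "P' \<in> carrier_mat m m"
    "Q \<in> carrier_mat n n" "Q' \<in> carrier_mat n n"
    "P * P' = 1\<^sub>m m" "P' * P = 1\<^sub>m m" "Q * Q' = 1\<^sub>m n" "Q' * Q = 1\<^sub>m n" "B = P * A * Q"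
    using mat_equivE[OF assms A] .
  have "P' * B * Q' = P' * (P * A * Q) * Q'" by (simp add: *)
  also have "\<dots> = (P' * P) * A * (Q * Q')"
    using *(1-4) A by (simp add: assoc_mult_mat[of _ m m _ m _ n]
        assoc_mult_mat[of _ m m _ n _ n] assoc_mult_mat[of _ m n _ n _ n])
  also have "\<dots> = A" unfolding *(6,7) using A by simp
  finally have "A = P' * B * Q'" ..
  with * mat_equiv_carrier[OF assms A] show ?thesis
    by (intro mat_equivI[of B m n P' P Q' Q]) auto
qed

lemma mat_equiv_trans:
  assumes "mat_equiv A B" "mat_equiv B C"
  shows "mat_equiv A C"
proof -
  obtain m n where A: "A \<in> carrier_mat m n" by blast
  have B: "B \<in> carrier_mat m n" using mat_equiv_carrier[OF assms(1) A] .
  obtain P P' Q Q' where 1: "P \<in> carrier_mat m m" "P' \<in> carrier_mat m m"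
    "Q \<in> carrier_mat n n" "Q' \<in> carrier_mat n n"
    "P * P' = 1\<^sub>m m" "P' * P = 1\<^sub>m m" "Q * Q' = 1\<^sub>m n" "Q' * Q = 1\<^sub>m n" "B = P * A * Q"
    using mat_equivE[OF assms(1) A] .
  obtain R R' S S' where 2: "R \<in> carrier_mat m m" "R' \<in> carrier_mat m m"
    "S \<in> carrier_mat n n" "S' \<in> carrier_mat n n"
    "R * R' = 1\<^sub>m m" "R' * R = 1\<^sub>m m" "S * S' = 1\<^sub>m n" "S' * S = 1\<^sub>m n" "C = R * B * S"
    using mat_equivE[OF assms(2) B] .
  have inv: "(X * Y) * (Y' * X') = 1\<^sub>m k"
    if "X \<in> carrier_mat k k" "Y \<in> carrier_mat k k" "X' \<in> carrier_mat k k" "Y' \<in> carrier_mat k k"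
      "Y * Y' = 1\<^sub>m k" "X * X' = 1\<^sub>m k" for X Y X' Y' :: "'a mat" and k
  proof -
    have "(X * Y) * (Y' * X') = X * ((Y * Y') * X')"
      using that(1-4) by (simp add: assoc_mult_mat[of _ k k _ k _ k])
    then show ?thesis using that by simp
  qed
  have "C = (R * P) * A * (Q * S)"
    using 1 2 A by (simp add: assoc_mult_mat[of _ m m _ m _ n]
        assoc_mult_mat[of _ m m _ n _ n] assoc_mult_mat[of _ m n _ n _ n])
  with 1 2 A show ?thesis
    by (intro mat_equivI[of A m n "R * P" "P' * R'" "Q * S" "S' * Q'"]) (auto intro!: inv)
qed

lemma mult_mat_index:
  assumes "X \<in> carrier_mat m k" "Y \<in> carrier_mat k n" "i < m" "j < n"
  shows "(X * Y) $$ (i, j) = (\<Sum>l = 0..<k. X $$ (i, l) * Y $$ (l, j))"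
  using assms by (simp add: scalar_prod_def)

lemma mat_equiv_dvd:
  assumes "mat_equiv A B" "A \<in> carrier_mat m n"
    and "\<And>i j. i < m \<Longrightarrow> j < n \<Longrightarrow> a dvd A $$ (i, j)" "i < m" "j < n"
  shows "a dvd B $$ (i, j)"
proof -
  obtain P P' Q Q' where *: "P \<in> carrier_mat m m" "P' \<in> carrier_mat m m"
    "Q \<in> carrier_mat n n" "Q' \<in> carrier_mat n n"
    "P * P' = 1\<^sub>m m" "P' * P = 1\<^sub>m m" "Q * Q' = 1\<^sub>m n" "Q' * Q = 1\<^sub>m n" "B = P * A * Q"
    using mat_equivE[OF assms(1,2)] .
  have 1: "a dvd (P * A) $$ (i, j)" if "i < m" "j < n" for i j
    using that * assms(2,3) by (auto simp: scalar_prod_def intro!: dvd_sum)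
  show ?thesis
    unfolding *(9) using assms(2,4,5) *(1-4) 1
    by (subst mult_mat_index[of _ m n _ n]) (auto intro!: dvd_sum dvd_mult2)
qed

lemma mat_equiv_reindex:
  fixes A :: "'r :: comm_ring_1 mat"
  assumes A: "A \<in> carrier_mat m n"
    and f: "bij_betw f {..<m} {..<m}" and g: "bij_betw g {..<n} {..<n}"
  shows "mat_equiv A (mat m n (\<lambda>(i, j). A $$ (f i, g j)))"
proof -
  define P where "P k h = mat k k (\<lambda>(i, j). if h i = j then 1 else 0 :: 'r)" for k and h :: "nat \<Rightarrow> nat"
  define P' where "P' k h = mat k k (\<lambda>(i, j). if h j = i then 1 else 0 :: 'r)" for k and h :: "nat \<Rightarrow> nat"
  have c [simp]: "P k h \<in> carrier_mat k k" "P' k h \<in> carrier_mat k k" for k h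
    by (auto simp: P_def P'_def)
  have h_less: "h i < k" if "bij_betw h {..<k} {..<k}" "i < k" for h i k
    using that by (auto dest: bij_betwE)
  have PP': "P k h * P' k h = 1\<^sub>m k" if h: "bij_betw h {..<k} {..<k}" for k h
  proof (rule eq_matI)
    fix i j assume "i < dim_row (1\<^sub>m k :: 'r mat)" "j < dim_col (1\<^sub>m k :: 'r mat)"
    then have "i < k" "j < k" by simp_all
    have "row (mat k k (\<lambda>(i, j). if h i = j then 1 else 0)) i \<bullet> col (mat k k (\<lambda>(i, j). if h j = i then 1 else 0)) j
      = (\<Sum>l = 0..<k. if l = h i then (if h j = h i then 1 else 0 :: 'r) else 0)"
      using \<open>i < k\<close> \<open>j < k\<close> by (simp add: scalar_prod_def if_distrib[of "\<lambda>x. x * _"] eq_commute[of "h i"] cong: if_cong)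
    also have "\<dots> = (if h j = h i then 1 else 0)"
      using h_less[OF h \<open>i < k\<close>] by simp
    also have "\<dots> = (if i = j then 1 else 0)"
      using h \<open>i < k\<close> \<open>j < k\<close> by (auto simp: bij_betw_def inj_on_def)
    finally have "row (mat k k (\<lambda>(i, j). if h i = j then 1 else 0)) i \<bullet> col (mat k k (\<lambda>(i, j). if h j = i then 1 else 0)) j
      = (if i = j then 1 else 0 :: 'r)" .
    then show "(P k h * P' k h) $$ (i, j) = 1\<^sub>m k $$ (i, j)"
      using \<open>i < k\<close> \<open>j < k\<close> by (simp add: P_def P'_def)
  qed (simp_all add: P_def P'_def)
  \<comment> \<open>For the inverse permutation the two matrices exchange roles, which reduces this
    product to the previous one.\<close>
  have P'P: "P' k h * P k h = 1\<^sub>m k" if h: "bij_betw h {..<k} {..<k}" for k h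
  proof -
    define h' where "h' = the_inv_into {..<k} h"
    have h': "bij_betw h' {..<k} {..<k}"
      unfolding h'_def by (rule bij_betw_the_inv_into[OF h])
    have "h i = j \<longleftrightarrow> h' j = i" if "i < k" "j < k" for i j
      using h that unfolding h'_def by (metis bij_betw_def f_the_inv_into_f_bij_betw lessThan_iff the_inv_into_f_f)
    then have "P' k h = P k h'" "P k h = P' k h'"
      by (auto simp: P_def P'_def)
    then show ?thesis using PP'[OF h'] by simp
  qed
  have "mat m n (\<lambda>(i, j). A $$ (f i, g j)) = P m f * A * P' n g"
  proof (rule eq_matI)
    fix i j assume i: "i < dim_row (P m f * A * P' n g)" and j: "j < dim_col (P m f * A * P' n g)"
    then have i: "i < m" and j: "j < n" by (auto simp: P_def P'_def)
    have PA: "(P m f * A) $$ (i, l) = A $$ (f i, l)" if "l < n" for l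
    proof -
      have "(P m f * A) $$ (i, l) = (\<Sum>k = 0..<m. if k = f i then A $$ (f i, l) else 0)"
        by (subst mult_mat_index[of _ m m _ n])
          (use i that A in \<open>simp_all add: P_def if_distrib[of "\<lambda>x. x * _"] eq_commute[of "f i"] cong: if_cong\<close>)
      then show ?thesis using h_less[OF f i] by simp
    qed
    have "(P m f * A * P' n g) $$ (i, j) = (\<Sum>k = 0..<n. (P m f * A) $$ (i, k) * P' n g $$ (k, j))"
      by (rule mult_mat_index[OF mult_carrier_mat[OF c(1) A] c(2) i j])
    also have "\<dots> = (\<Sum>k = 0..<n. if k = g j then A $$ (f i, g j) else 0)"
      using j by (intro sum.cong refl, subst PA) (auto simp: P'_def)
    also have "\<dots> = A $$ (f i, g j)" using h_less[OF g j] by simp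
    finally show "mat m n (\<lambda>(i, j). A $$ (f i, g j)) $$ (i, j) = (P m f * A * P' n g) $$ (i, j)"
      using i j by simp
  qed (use A in \<open>auto simp: P_def P'_def\<close>)
  then show ?thesis
    using PP'[OF f] P'P[OF f] PP'[OF g] P'P[OF g] A c
    by (intro mat_equivI[of A m n "P m f" "P' m f" "P' n g" "P n g"]) auto
qed

section \<open>Unipotent row and column operations on block matrices\<close>

lemma uminus_zero_mat: "- 0\<^sub>m m n = (0\<^sub>m m n :: 'r :: group_add mat)"
  by (rule eq_matI) auto

lemma add_uminus_mat: "X \<in> carrier_mat m n \<Longrightarrow> X + - X = (0\<^sub>m m n :: 'r :: group_add mat)"
  by (rule eq_matI) auto

lemma upper_unipotent_inverse:
  fixes X :: "'r :: comm_ring_1 mat"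
  assumes "X \<in> carrier_mat m n"
  shows "four_block_mat (1\<^sub>m m) X (0\<^sub>m n m) (1\<^sub>m n) * four_block_mat (1\<^sub>m m) (- X) (0\<^sub>m n m) (1\<^sub>m n) = 1\<^sub>m (m + n)"
    and "four_block_mat (1\<^sub>m m) (- X) (0\<^sub>m n m) (1\<^sub>m n) * four_block_mat (1\<^sub>m m) X (0\<^sub>m n m) (1\<^sub>m n) = 1\<^sub>m (m + n)"
  using assms
  by (subst mult_four_block_mat[of _ m m _ n _ n _ _ m _ n]; auto simp: uminus_zero_mat add_uminus_mat)+

lemma lower_unipotent_inverse:
  fixes X :: "'r :: comm_ring_1 mat"
  assumes "X \<in> carrier_mat n m"
  shows "four_block_mat (1\<^sub>m m) (0\<^sub>m m n) X (1\<^sub>m n) * four_block_mat (1\<^sub>m m) (0\<^sub>m m n) (- X) (1\<^sub>m n) = 1\<^sub>m (m + n)"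
    and "four_block_mat (1\<^sub>m m) (0\<^sub>m m n) (- X) (1\<^sub>m n) * four_block_mat (1\<^sub>m m) (0\<^sub>m m n) X (1\<^sub>m n) = 1\<^sub>m (m + n)"
  using assms
  by (subst mult_four_block_mat[of _ m m _ n _ n _ _ m _ n]; auto simp: uminus_zero_mat add_uminus_mat)+

context
  fixes A B C D :: "'r :: comm_ring_1 mat" and m1 m2 n1 n2 :: nat
  assumes carr: "A \<in> carrier_mat m1 n1" "B \<in> carrier_mat m1 n2" "C \<in> carrier_mat m2 n1" "D \<in> carrier_mat m2 n2"
begin

text \<open>Right multiplication by a unipotent matrix. When \<open>C\<close> is zero, the lower
  block row does not change and only the upper right block is modified.\<close>

lemma mat_equiv_col_op:
  assumes X: "X \<in> carrier_mat n1 n2"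
  shows "mat_equiv (four_block_mat A B C D) (four_block_mat A (A * X + B) C (C * X + D))"
proof (rule mat_equivI[of _ "m1 + m2" "n1 + n2" "1\<^sub>m _" "1\<^sub>m _"])
  show "four_block_mat A (A * X + B) C (C * X + D)
    = 1\<^sub>m (m1 + m2) * four_block_mat A B C D * four_block_mat (1\<^sub>m n1) X (0\<^sub>m n2 n1) (1\<^sub>m n2)"
    using carr X by (subst left_mult_one_mat[of _ "m1 + m2" "n1 + n2"], simp)
      (subst mult_four_block_mat[of _ m1 n1 _ n2 _ m2 _ _ n1 _ n2]; auto)
qed (use carr X upper_unipotent_inverse[OF X] in auto)

lemma mat_equiv_row_op:
  assumes X: "X \<in> carrier_mat m1 m2"
  shows "mat_equiv (four_block_mat A B C D) (four_block_mat (A + X * C) (B + X * D) C D)"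
proof (rule mat_equivI[of _ "m1 + m2" "n1 + n2" _ _ "1\<^sub>m _" "1\<^sub>m _"])
  have "four_block_mat A B C D \<in> carrier_mat (m1 + m2) (n1 + n2)" using carr by simp
  then show "four_block_mat (A + X * C) (B + X * D) C D
    = four_block_mat (1\<^sub>m m1) X (0\<^sub>m m2 m1) (1\<^sub>m m2) * four_block_mat A B C D * 1\<^sub>m (n1 + n2)"
    using carr X by (subst right_mult_one_mat[of _ "m1 + m2" "n1 + n2"], (intro mult_carrier_mat[of _ _ "m1 + m2"] four_block_carrier_mat; simp))
      (subst mult_four_block_mat[of _ m1 m1 _ m2 _ m2 _ _ n1 _ n2]; auto)
qed (use carr X upper_unipotent_inverse[OF X] in auto)

text \<open>The downward counterpart of \<open>mat_equiv_row_op\<close>; it handles the column of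
  the pivot in the Smith form.\<close>

lemma mat_equiv_row_op':
  assumes X: "X \<in> carrier_mat m2 m1"
  shows "mat_equiv (four_block_mat A B C D) (four_block_mat A B (X * A + C) (X * B + D))"
proof (rule mat_equivI[of _ "m1 + m2" "n1 + n2" _ _ "1\<^sub>m _" "1\<^sub>m _"])
  have "four_block_mat A B C D \<in> carrier_mat (m1 + m2) (n1 + n2)" using carr by simp
  then show "four_block_mat A B (X * A + C) (X * B + D)
    = four_block_mat (1\<^sub>m m1) (0\<^sub>m m1 m2) X (1\<^sub>m m2) * four_block_mat A B C D * 1\<^sub>m (n1 + n2)"
    using carr X by (subst right_mult_one_mat[of _ "m1 + m2" "n1 + n2"], (intro mult_carrier_mat[of _ _ "m1 + m2"] four_block_carrier_mat; simp))
      (subst mult_four_block_mat[of _ m1 m1 _ m2 _ m2 _ _ n1 _ n2]; auto)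
qed (use carr X lower_unipotent_inverse[OF X] in auto)

end

lemma mat_equiv_block_diag:
  fixes A D :: "'r :: comm_ring_1 mat"
  assumes A: "A \<in> carrier_mat m1 n1" and D: "D \<in> carrier_mat m2 n2"
    and "mat_equiv A A'" "mat_equiv D D'"
  shows "mat_equiv (four_block_mat A (0\<^sub>m m1 n2) (0\<^sub>m m2 n1) D) (four_block_mat A' (0\<^sub>m m1 n2) (0\<^sub>m m2 n1) D')"
proof -
  obtain P P' Q Q' where 1: "P \<in> carrier_mat m1 m1" "P' \<in> carrier_mat m1 m1"
    "Q \<in> carrier_mat n1 n1" "Q' \<in> carrier_mat n1 n1"
    "P * P' = 1\<^sub>m m1" "P' * P = 1\<^sub>m m1" "Q * Q' = 1\<^sub>m n1" "Q' * Q = 1\<^sub>m n1" "A' = P * A * Q"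
    using mat_equivE[OF assms(3) A] .
  obtain R R' S S' where 2: "R \<in> carrier_mat m2 m2" "R' \<in> carrier_mat m2 m2"
    "S \<in> carrier_mat n2 n2" "S' \<in> carrier_mat n2 n2"
    "R * R' = 1\<^sub>m m2" "R' * R = 1\<^sub>m m2" "S * S' = 1\<^sub>m n2" "S' * S = 1\<^sub>m n2" "D' = R * D * S"
    using mat_equivE[OF assms(4) D] .
  let ?d = "\<lambda>m n m' n' X Y. four_block_mat X (0\<^sub>m m n') (0\<^sub>m m' n) Y :: 'r mat"
  have mult: "?d m n m' n' X Y * ?d n k n' k' X' Y' = ?d m k m' k' (X * X') (Y * Y')"
    if "X \<in> carrier_mat m n" "Y \<in> carrier_mat m' n'" "X' \<in> carrier_mat n k" "Y' \<in> carrier_mat n' k'"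
    for m n m' n' k k' X Y X' Y'
    using that by (subst mult_four_block_mat[of _ m n _ n' _ m' _ _ k _ k']; auto)
  show ?thesis
    by (rule mat_equivI[of _ "m1 + m2" "n1 + n2" "?d m1 m1 m2 m2 P R" "?d m1 m1 m2 m2 P' R'"
          "?d n1 n1 n2 n2 Q S" "?d n1 n1 n2 n2 Q' S'"])
      (use 1 2 A D in \<open>auto simp: mult\<close>)
qed

section \<open>Smith normal form over a discrete valuation ring\<close>

text \<open>
  A block sum of diagonal matrices need not be diagonal, as the blocks are not square, but it still
  has at most one nonzero entry in each row and column.
\<close>

definition monomial_mat :: "'r :: comm_ring_1 mat \<Rightarrow> bool" where
  "monomial_mat D \<longleftrightarrow>
     (\<forall>i < dim_row D. \<forall>i' < dim_row D. \<forall>j < dim_col D. \<forall>j' < dim_col D.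
        D $$ (i, j) \<noteq> 0 \<longrightarrow> D $$ (i', j') \<noteq> 0 \<longrightarrow> i = i' \<longleftrightarrow> j = j')"

text \<open>At \<open>a = \<pi>^k\<close> and for a monomial matrix over a discrete valuation ring,
  its cardinality counts the invariant factors of valuation below \<open>k\<close>. Zero entries
  never count, so rank deficiency needs no separate treatment.\<close>

definition entries_not_dvd :: "'r :: comm_ring_1 \<Rightarrow> 'r mat \<Rightarrow> (nat \<times> nat) set" where
  "entries_not_dvd a D = {(i, j). i < dim_row D \<and> j < dim_col D \<and> \<not> a dvd D $$ (i, j)}"

lemma finite_entries_not_dvd: "finite (entries_not_dvd a D)"
  by (rule finite_subset[of _ "{..<dim_row D} \<times> {..<dim_col D}"]) (auto simp: entries_not_dvd_def)

lemma diagonal_imp_monomial_mat: "diagonal_mat D \<Longrightarrow> monomial_mat D"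
  unfolding diagonal_mat_def monomial_mat_def by blast

lemma monomial_mat_block_diag:
  assumes "monomial_mat A" "monomial_mat D" "A \<in> carrier_mat m1 n1" "D \<in> carrier_mat m2 n2"
  shows "monomial_mat (four_block_mat A (0\<^sub>m m1 n2) (0\<^sub>m m2 n1) D)"
proof -
  have *: "i = i' \<longleftrightarrow> j = j'"
    if ij: "i < m1 + m2" "i' < m1 + m2" "j < n1 + n2" "j' < n1 + n2"
      and nz: "four_block_mat A (0\<^sub>m m1 n2) (0\<^sub>m m2 n1) D $$ (i, j) \<noteq> 0"
        "four_block_mat A (0\<^sub>m m1 n2) (0\<^sub>m m2 n1) D $$ (i', j') \<noteq> 0" for i i' j j'
  proof -
    have 1: "i < m1 \<and> j < n1 \<and> A $$ (i, j) \<noteq> 0 \<or> i \<ge> m1 \<and> j \<ge> n1 \<and> D $$ (i - m1, j - n1) \<noteq> 0"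
      using nz ij assms(3,4) by (auto split: if_splits)
    have 2: "i' < m1 \<and> j' < n1 \<and> A $$ (i', j') \<noteq> 0 \<or> i' \<ge> m1 \<and> j' \<ge> n1 \<and> D $$ (i' - m1, j' - n1) \<noteq> 0"
      using nz ij assms(3,4) by (auto split: if_splits)
    have A: "i = i' \<longleftrightarrow> j = j'" if "i < m1" "i' < m1" "j < n1" "j' < n1"
      "A $$ (i, j) \<noteq> 0" "A $$ (i', j') \<noteq> 0"
      using that assms(1,3) unfolding monomial_mat_def by auto
    have D: "i - m1 = i' - m1 \<longleftrightarrow> j - n1 = j' - n1" if "i - m1 < m2" "i' - m1 < m2" "j - n1 < n2" "j' - n1 < n2"
      "D $$ (i - m1, j - n1) \<noteq> 0" "D $$ (i' - m1, j' - n1) \<noteq> 0"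
      using that assms(2,4) unfolding monomial_mat_def by auto
    show ?thesis
    proof (cases "i < m1"; cases "i' < m1")
      assume "i < m1" "i' < m1"
      then show ?thesis using 1 2 A by linarith
    next
      assume i: "\<not> i < m1" "\<not> i' < m1"
      then have "i - m1 < m2" "i' - m1 < m2" "j - n1 < n2" "j' - n1 < n2" "j \<ge> n1" "j' \<ge> n1"
        using 1 2 ij by linarith+
      with i 1 2 D show ?thesis by (metis eq_diff_iff linorder_not_less)
    qed (use 1 2 in auto)
  qed
  show ?thesis
    unfolding monomial_mat_def
  proof (intro allI impI)
    fix i i' j j'
    assume "i < dim_row (four_block_mat A (0\<^sub>m m1 n2) (0\<^sub>m m2 n1) D)"
      "i' < dim_row (four_block_mat A (0\<^sub>m m1 n2) (0\<^sub>m m2 n1) D)"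
      "j < dim_col (four_block_mat A (0\<^sub>m m1 n2) (0\<^sub>m m2 n1) D)"
      "j' < dim_col (four_block_mat A (0\<^sub>m m1 n2) (0\<^sub>m m2 n1) D)"
      "four_block_mat A (0\<^sub>m m1 n2) (0\<^sub>m m2 n1) D $$ (i, j) \<noteq> 0"
      "four_block_mat A (0\<^sub>m m1 n2) (0\<^sub>m m2 n1) D $$ (i', j') \<noteq> 0"
    then show "i = i' \<longleftrightarrow> j = j'"
      using assms(3,4) by (intro *) (simp_all del: index_mat_four_block(1))
  qed
qed

lemma card_entries_not_dvd_block_diag:
  assumes "A \<in> carrier_mat m1 n1" "D \<in> carrier_mat m2 n2"
  shows "card (entries_not_dvd a (four_block_mat A (0\<^sub>m m1 n2) (0\<^sub>m m2 n1) D))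
    = card (entries_not_dvd a A) + card (entries_not_dvd a D)"
proof -
  have "entries_not_dvd a (four_block_mat A (0\<^sub>m m1 n2) (0\<^sub>m m2 n1) D)
    = entries_not_dvd a A \<union> (\<lambda>(i, j). (i + m1, j + n1)) ` entries_not_dvd a D" (is "?L = ?R")
  proof (intro equalityI subsetI)
    fix x assume "x \<in> ?L"
    then obtain i j where x: "x = (i, j)" and "i < m1 + m2" "j < n1 + n2"
      "\<not> a dvd four_block_mat A (0\<^sub>m m1 n2) (0\<^sub>m m2 n1) D $$ (i, j)"
      using assms by (auto simp: entries_not_dvd_def)
    then have "i < m1 \<and> j < n1 \<and> \<not> a dvd A $$ (i, j) \<or> i \<ge> m1 \<and> j \<ge> n1 \<and> \<not> a dvd D $$ (i - m1, j - n1)"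
      using assms by (auto split: if_splits)
    then show "x \<in> ?R"
    proof
      assume "i \<ge> m1 \<and> j \<ge> n1 \<and> \<not> a dvd D $$ (i - m1, j - n1)"
      then have "(i - m1, j - n1) \<in> entries_not_dvd a D" "x = (\<lambda>(i, j). (i + m1, j + n1)) (i - m1, j - n1)"
        using \<open>i < m1 + m2\<close> \<open>j < n1 + n2\<close> assms by (auto simp: entries_not_dvd_def x)
      then show ?thesis by blast
    qed (use assms x in \<open>auto simp: entries_not_dvd_def\<close>)
  qed (use assms in \<open>auto simp: entries_not_dvd_def\<close>)
  moreover have "entries_not_dvd a A \<inter> (\<lambda>(i, j). (i + m1, j + n1)) ` entries_not_dvd a D = {}"
    using assms by (auto simp: entries_not_dvd_def)
  moreover have "inj_on (\<lambda>(i, j). (i + m1, j + n1)) (entries_not_dvd a D)"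
    by (auto simp: inj_on_def)
  ultimately show ?thesis
    by (simp add: card_Un_disjoint finite_entries_not_dvd card_image)
qed

text \<open>An abstract discrete valuation ring. Nonzero elements are units times powers of \<pi>
  and these powers do not vanish, so there are no zero divisors although the class is only
  \<open>comm_ring_1\<close>, the one that \<open>padic_int\<close> is an instance of.\<close>

locale uniformizer =
  fixes \<pi> :: "'r :: comm_ring_1"
  assumes not_unit: "\<not> \<pi> dvd 1"
    and power_nonzero: "\<pi> ^ k \<noteq> 0"
    and decompose: "x \<noteq> 0 \<Longrightarrow> \<exists>u k. u dvd 1 \<and> x = u * \<pi> ^ k"
begin

lemma not_dvd_imp_unit: "\<not> \<pi> dvd x \<Longrightarrow> x dvd 1"
proof -
  assume x: "\<not> \<pi> dvd x"
  then have "x \<noteq> 0" by auto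
  then obtain u k where "u dvd 1" "x = u * \<pi> ^ k" using decompose by blast
  with x show ?thesis by (cases k) auto
qed

text \<open>Nonzero elements are associated to powers of \<pi>, which form a chain under
  divisibility.\<close>

lemma dvd_total: "(x :: 'r) dvd y \<or> y dvd x"
proof (cases "x = 0 \<or> y = 0")
  case False
  then obtain u k v l where *: "u dvd 1" "x = u * \<pi> ^ k" "v dvd 1" "y = v * \<pi> ^ l"
    using decompose by metis
  then have "x dvd \<pi> ^ k" "\<pi> ^ k dvd x" "y dvd \<pi> ^ l" "\<pi> ^ l dvd y"
    using mult_dvd_mono[of u 1 "\<pi> ^ k" "\<pi> ^ k"] mult_dvd_mono[of v 1 "\<pi> ^ l" "\<pi> ^ l"] by auto
  moreover have "\<pi> ^ k dvd \<pi> ^ l \<or> \<pi> ^ l dvd \<pi> ^ k"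
    by (metis le_imp_power_dvd linear)
  ultimately show ?thesis by (meson dvd_trans)
qed auto

text \<open>Otherwise \<open>x\<close> is a unit, and multiplying \<open>d * x\<close> by its
  inverse carries the divisibility over to \<open>d\<close>.\<close>

lemma power_dvd_mult_imp:
  assumes "\<pi> ^ k dvd d * x" "\<not> \<pi> ^ k dvd d"
  shows "\<pi> dvd x"
proof (rule ccontr)
  assume "\<not> \<pi> dvd x"
  then obtain y where "1 = x * y" using not_dvd_imp_unit by blast
  then have "d = d * x * y" by (simp add: mult.assoc)
  then have "\<pi> ^ k dvd d" by (metis assms(1) dvd_mult2)
  with assms(2) show False ..
qed

text \<open>A quotient \<open>c\<close> would give \<open>\<pi>^k * (1 - \<pi> * c) = 0\<close>,
  where the second factor is a unit.\<close>

lemma power_Suc_not_dvd: "\<not> \<pi> ^ Suc k dvd \<pi> ^ k"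
proof
  assume "\<pi> ^ Suc k dvd \<pi> ^ k"
  then obtain c where c: "\<pi> ^ k = \<pi> ^ Suc k * c" by auto
  then have "\<pi> ^ k * (1 - \<pi> * c) = 0" by (simp add: algebra_simps)
  moreover have "\<not> \<pi> dvd 1 - \<pi> * c"
    using not_unit by (metis dvd_triv_left dvd_diffD dvd_add_right_iff diff_add_cancel)
  then obtain y where "1 = (1 - \<pi> * c) * y" using not_dvd_imp_unit by blast
  ultimately have "\<pi> ^ k = 0" by (metis mult.assoc mult_1_right mult_zero_left)
  then show False using power_nonzero by blast
qed

text \<open>This turns a multiplicity into the difference of two counts of non-divisible
  elements.\<close>

lemma eq_up_to_unit_power_iff: "eq_up_to_unit d (\<pi> ^ k) \<longleftrightarrow> \<pi> ^ k dvd d \<and> \<not> \<pi> ^ Suc k dvd d"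
proof
  assume "eq_up_to_unit d (\<pi> ^ k)"
  then obtain u where u: "u dvd 1" "d = u * \<pi> ^ k" unfolding eq_up_to_unit_def by blast
  have "\<not> \<pi> ^ Suc k dvd d"
  proof
    assume "\<pi> ^ Suc k dvd d"
    then have "\<pi> dvd u"
      using power_dvd_mult_imp[of "Suc k" "\<pi> ^ k" u] power_Suc_not_dvd u by (simp add: mult.commute)
    with u not_unit show False using dvd_trans by blast
  qed
  with u show "\<pi> ^ k dvd d \<and> \<not> \<pi> ^ Suc k dvd d" by simp
next
  assume *: "\<pi> ^ k dvd d \<and> \<not> \<pi> ^ Suc k dvd d"
  then obtain u where u: "d = \<pi> ^ k * u" by auto
  with * have "\<not> \<pi> dvd u" using mult_dvd_mono[of "\<pi> ^ k" "\<pi> ^ k" \<pi> u] by (auto simp: mult.commute)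
  then show "eq_up_to_unit d (\<pi> ^ k)"
    unfolding eq_up_to_unit_def using not_dvd_imp_unit u by (metis mult.commute)
qed

text \<open>By the pigeonhole principle each permutation in the Leibniz formula sends some row of
  \<open>I\<close> to a column outside \<open>J\<close>, so every term contains a factor divisible
  by \<open>a\<close>.\<close>

lemma det_dvd_of_zero_block:
  assumes A: "A \<in> carrier_mat n n" and IJ: "I \<subseteq> {..<n}" "finite J" "card J < card I"
    and dvd: "\<And>i j. i \<in> I \<Longrightarrow> j < n \<Longrightarrow> j \<notin> J \<Longrightarrow> a dvd A $$ (i, j)"
  shows "a dvd det A"
proof -
  have "a dvd (\<Prod>i = 0..<n. A $$ (i, \<sigma> i))" if \<sigma>: "\<sigma> permutes {0..<n}" for \<sigma>
  proof -
    have "\<not> \<sigma> ` I \<subseteq> J"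
    proof
      assume "\<sigma> ` I \<subseteq> J"
      moreover have "inj_on \<sigma> I"
        using permutes_inj[OF \<sigma>] inj_on_subset by blast
      ultimately have "card I \<le> card J" using IJ(2) card_inj_on_le by blast
      with IJ(3) show False by simp
    qed
    then obtain i where i: "i \<in> I" "\<sigma> i \<notin> J" by blast
    moreover have "i < n" using i IJ by auto
    moreover have "\<sigma> i < n" using \<sigma> \<open>i < n\<close> permutes_in_image[OF \<sigma>, of i] by simp
    ultimately have "a dvd A $$ (i, \<sigma> i)" using dvd by simp
    moreover have "A $$ (i, \<sigma> i) dvd (\<Prod>i = 0..<n. A $$ (i, \<sigma> i))"
      using \<open>i < n\<close> by (intro dvd_prodI) auto
    ultimately show ?thesis by (rule dvd_trans)
  qed
  then show ?thesis
    unfolding det_def'[OF A] by (intro dvd_sum dvd_mult) auto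
qed

text \<open>
  If \<open>D'\<close> had more entries outside \<open>(\<pi>\<^sup>k)\<close> than \<open>D\<close>, then the identity \<open>D' Q' = P D\<close> would force so large
  a block of zeros modulo \<open>\<pi>\<close> in the invertible matrix \<open>Q'\<close> that \<open>\<pi>\<close> divides its determinant.
\<close>

lemma card_entries_not_dvd_le:
  assumes equiv: "mat_equiv D D'" and D: "D \<in> carrier_mat m n"
    and mono: "monomial_mat D" "monomial_mat D'"
  shows "card (entries_not_dvd (\<pi> ^ k) D') \<le> card (entries_not_dvd (\<pi> ^ k) D)"
proof (rule ccontr)
  let ?S = "entries_not_dvd (\<pi> ^ k) D" and ?S' = "entries_not_dvd (\<pi> ^ k) D'"
  assume "\<not> card ?S' \<le> card ?S"
  obtain P P' Q Q' where *: "P \<in> carrier_mat m m" "P' \<in> carrier_mat m m"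
    "Q \<in> carrier_mat n n" "Q' \<in> carrier_mat n n"
    "P * P' = 1\<^sub>m m" "P' * P = 1\<^sub>m m" "Q * Q' = 1\<^sub>m n" "Q' * Q = 1\<^sub>m n" "D' = P * D * Q"
    using mat_equivE[OF equiv D] .
  have D': "D' \<in> carrier_mat m n" using mat_equiv_carrier[OF equiv D] .
  have "D' * Q' = (P * D) * (Q * Q')"
    unfolding *(9) by (rule assoc_mult_mat[of _ m n _ n _ n]) (use * D in auto)
  then have eq: "D' * Q' = P * D" using * D by (simp add: right_mult_one_mat[of _ m n])
  \<comment> \<open>Monomiality puts the counted entries of \<open>D'\<close> into different
    columns, so the block has exactly \<open>card ?S'\<close> rows; for \<open>?S\<close> an upper
    bound on the number of columns is enough.\<close>
  have "inj_on snd ?S'"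
    using mono(2) unfolding monomial_mat_def inj_on_def entries_not_dvd_def by fastforce
  then have 1: "card (snd ` ?S') = card ?S'" by (rule card_image)
  have 2: "card (snd ` ?S) \<le> card ?S" by (rule card_image_le[OF finite_entries_not_dvd])
  \<comment> \<open>Row \<open>i\<close> of \<open>D'\<close> has a single nonzero entry, in column
    \<open>j'\<close>, so the \<open>(i, l)\<close> entry of \<open>D' * Q'\<close> is a single
    product. Column \<open>l\<close> of \<open>D\<close> is divisible by \<open>\<pi>^k\<close>,
    hence so is this product, while its factor from \<open>D'\<close> is not.\<close>
  have "\<pi> dvd Q' $$ (j', l)" if j': "j' \<in> snd ` ?S'" and l: "l < n" "l \<notin> snd ` ?S" for j' l
  proof -
    obtain i where i: "i < m" "j' < n" "\<not> \<pi> ^ k dvd D' $$ (i, j')"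
      using j' D' by (force simp: entries_not_dvd_def)
    then have nz: "D' $$ (i, j') \<noteq> 0" by auto
    have "D' $$ (i, j) = 0" if "j < n" "j \<noteq> j'" for j
      using mono(2) nz i that D' unfolding monomial_mat_def by auto
    then have "(\<Sum>j = 0..<n. D' $$ (i, j) * Q' $$ (j, l)) = (\<Sum>j = 0..<n. if j = j' then D' $$ (i, j') * Q' $$ (j', l) else 0)"
      by (intro sum.cong) auto
    then have "(D' * Q') $$ (i, l) = D' $$ (i, j') * Q' $$ (j', l)"
      using D' *(4) i l by (simp add: mult_mat_index[of _ m n _ n] del: index_mult_mat)
    moreover have "(P * D) $$ (i, l) = (\<Sum>j = 0..<m. P $$ (i, j) * D $$ (j, l))"
      using i l D *(1) by (intro mult_mat_index[of _ m m _ n]) auto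
    moreover have "\<pi> ^ k dvd D $$ (j, l)" if "j < m" for j
      using l that D unfolding entries_not_dvd_def by force
    then have "\<pi> ^ k dvd (\<Sum>j = 0..<m. P $$ (i, j) * D $$ (j, l))"
      by (intro dvd_sum dvd_mult) auto
    ultimately have "\<pi> ^ k dvd D' $$ (i, j') * Q' $$ (j', l)"
      using eq by simp
    then show ?thesis using i power_dvd_mult_imp by blast
  qed
  then have "\<pi> dvd det Q'"
    by (intro det_dvd_of_zero_block[OF *(4), of "snd ` ?S'" "snd ` ?S"])
      (use 1 2 \<open>\<not> card ?S' \<le> card ?S\<close> D' in \<open>auto simp: entries_not_dvd_def finite_entries_not_dvd[unfolded entries_not_dvd_def]\<close>)
  moreover have "det Q' * det Q = 1"
    using det_mult[OF *(4,3)] *(8) by simp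
  ultimately have "\<pi> dvd 1" by (metis dvd_mult2)
  with not_unit show False ..
qed

lemma card_entries_not_dvd_eq:
  assumes "mat_equiv D D'" "monomial_mat D" "monomial_mat D'"
  shows "card (entries_not_dvd (\<pi> ^ k) D) = card (entries_not_dvd (\<pi> ^ k) D')"
  using card_entries_not_dvd_le[OF assms(1) carrier_matI[OF refl refl] assms(2,3)]
    card_entries_not_dvd_le[OF mat_equiv_sym[OF assms(1)] carrier_matI[OF refl refl] assms(3,2)]
  by (intro antisym)

lemma exists_least_dvd:
  fixes S :: "'r set"
  assumes "finite S" "S \<noteq> {}"
  shows "\<exists>a\<in>S. \<forall>x\<in>S. a dvd x"
  using assms
proof (induction rule: finite_ne_induct)
  case (insert x F)
  then obtain a where "a \<in> F" "\<forall>y\<in>F. a dvd y" by blast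
  consider "a dvd x" | "x dvd a" using dvd_total by blast
  then show ?case
  proof cases
    case 1
    then show ?thesis using \<open>a \<in> F\<close> \<open>\<forall>y\<in>F. a dvd y\<close> by (intro bexI[of _ a]) auto
  next
    case 2
    then show ?thesis using \<open>\<forall>y\<in>F. a dvd y\<close> dvd_trans[of x a] by (intro bexI[of _ x]) auto
  qed
qed simp

text \<open>Since divisibility is total, some entry divides all others. Taken as the pivot, it
  clears its row and column at once without gcd steps, and it divides everything that
  remains.\<close>

lemma smith_form_exists:
  fixes A :: "'r mat"
  assumes "A \<in> carrier_mat m n"
  shows "\<exists>D. mat_equiv A D \<and> diagonal_mat D \<and> (\<forall>i j. i \<le> j \<longrightarrow> j < m \<longrightarrow> j < n \<longrightarrow> D $$ (i, i) dvd D $$ (j, j))"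
  using assms
proof (induction m arbitrary: n A)
  case 0
  then show ?case by (intro exI[of _ A]) (auto simp: mat_equiv_refl diagonal_mat_def)
next
  case (Suc m n A)
  show ?case
  proof (cases n)
    case 0
    with Suc.prems show ?thesis by (intro exI[of _ A]) (auto simp: mat_equiv_refl diagonal_mat_def)
  next
    case n: (Suc n')
    let ?S = "(\<lambda>(i, j). A $$ (i, j)) ` ({..<Suc m} \<times> {..<n})"
    have "finite ?S" "?S \<noteq> {}" using n by (auto simp: lessThan_empty_iff)
    from exists_least_dvd[OF this] obtain i0 j0 where ij0: "i0 < Suc m" "j0 < n"
      and min: "\<And>i j. i < Suc m \<Longrightarrow> j < n \<Longrightarrow> A $$ (i0, j0) dvd A $$ (i, j)"
      by fastforce
    define a where "a = A $$ (i0, j0)"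
    define A1 where "A1 = mat (Suc m) n (\<lambda>(i, j). A $$ (Transposition.transpose 0 i0 i, Transposition.transpose 0 j0 j))"
    have bij: "bij_betw (Transposition.transpose 0 k) {..<l} {..<l}" if "k < l" for k l :: nat
      using permutes_imp_bij[OF permutes_swap_id[of 0 "{..<l}" k]] that by auto
    have equiv1: "mat_equiv A A1"
      unfolding A1_def by (rule mat_equiv_reindex[OF Suc.prems bij[OF ij0(1)] bij[OF ij0(2)]])
    have A1: "A1 \<in> carrier_mat (Suc m) (Suc n')" using n by (simp add: A1_def)
    have A1_dvd: "a dvd A1 $$ (i, j)" if "i < Suc m" "j < n" for i j
      using mat_equiv_dvd[OF equiv1 Suc.prems _ that] min unfolding a_def by blast
    have "A1 $$ (0, 0) = a" using n by (simp add: A1_def a_def)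
    define A11 where "A11 = mat 1 1 (\<lambda>_. a)"
    have "\<exists>x. A1 $$ (i, j) = a * x" if "i < Suc m" "j < n" for i j
      using A1_dvd[OF that] by (auto elim: dvdE)
    then obtain q where q: "\<And>i j. i < Suc m \<Longrightarrow> j < n \<Longrightarrow> A1 $$ (i, j) = a * q i j" by metis
    define X where "X = mat 1 n' (\<lambda>(i, j). q 0 (Suc j))"
    define Z where "Z = mat m 1 (\<lambda>(i, j). q (Suc i) 0)"
    \<comment> \<open>The Schur complement of the pivot, written with the quotients \<open>q\<close>
      because the ring has no division.\<close>
    define E where "E = mat m n' (\<lambda>(i, j). A1 $$ (Suc i, Suc j) - a * q (Suc i) 0 * q 0 (Suc j))"
    have carr: "A11 \<in> carrier_mat 1 1" "X \<in> carrier_mat 1 n'" "Z \<in> carrier_mat m 1" "E \<in> carrier_mat m n'"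
      by (auto simp: A11_def X_def Z_def E_def)
    \<comment> \<open>The elimination is run backwards: from the block diagonal matrix,
      \<open>X\<close> restores the pivot row and then \<open>Z\<close> the pivot column together
      with \<open>A1\<close>'s remaining entries.\<close>
    have "mat_equiv (four_block_mat A11 (0\<^sub>m 1 n') (0\<^sub>m m 1) E)
       (four_block_mat A11 (A11 * X + 0\<^sub>m 1 n') (0\<^sub>m m 1) (0\<^sub>m m 1 * X + E))"
      by (rule mat_equiv_col_op[of _ 1 1 _ n' _ m]) (use carr in auto)
    moreover have "mat_equiv (four_block_mat A11 (A11 * X) (0\<^sub>m m 1) E)
       (four_block_mat A11 (A11 * X) (Z * A11 + 0\<^sub>m m 1) (Z * (A11 * X) + E))"
      by (rule mat_equiv_row_op'[of _ 1 1 _ n' _ m]) (use carr in auto)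
    moreover have "four_block_mat A11 (A11 * X) (Z * A11 + 0\<^sub>m m 1) (Z * (A11 * X) + E) = A1"
    proof (rule eq_matI)
      fix i j assume ij: "i < dim_row A1" "j < dim_col A1"
      then have ij: "i < Suc m" "j < Suc n'" using A1 by auto
      show "four_block_mat A11 (A11 * X) (Z * A11 + 0\<^sub>m m 1) (Z * (A11 * X) + E) $$ (i, j) = A1 $$ (i, j)"
        using ij q n \<open>A1 $$ (0, 0) = a\<close>
        by (cases i; cases j) (auto simp: A11_def X_def Z_def E_def scalar_prod_def algebra_simps)
    qed (use A1 carr in auto)
    ultimately have equiv2: "mat_equiv A1 (four_block_mat A11 (0\<^sub>m 1 n') (0\<^sub>m m 1) E)"
      using carr mat_equiv_sym[OF mat_equiv_trans[of "four_block_mat A11 (0\<^sub>m 1 n') (0\<^sub>m m 1) E" _ A1]]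
      by (simp add: right_add_zero_mat[of _ 1 n'] left_add_zero_mat[of _ m n'])
    obtain D2 where D2: "mat_equiv E D2" "diagonal_mat D2"
      "\<And>i j. i \<le> j \<Longrightarrow> j < m \<Longrightarrow> j < n' \<Longrightarrow> D2 $$ (i, i) dvd D2 $$ (j, j)"
      using Suc.IH[OF carr(4)] by blast
    have D2c: "D2 \<in> carrier_mat m n'" using mat_equiv_carrier[OF D2(1) carr(4)] .
    \<comment> \<open>Divisibility by the pivot passes from \<open>A1\<close> to \<open>E\<close>
      and through equivalence to \<open>D2\<close>, which continues the divisibility chain across
      the block boundary.\<close>
    have "a dvd E $$ (i, j)" if "i < m" "j < n'" for i j
      using A1_dvd[of "Suc i" "Suc j"] that n by (auto simp: E_def mult.assoc intro!: dvd_diff)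
    then have a_dvd: "a dvd D2 $$ (i, j)" if "i < m" "j < n'" for i j
      using mat_equiv_dvd[OF D2(1) carr(4) _ that] by blast
    let ?D = "four_block_mat A11 (0\<^sub>m 1 n') (0\<^sub>m m 1) D2"
    have "mat_equiv A ?D"
      using mat_equiv_block_diag[OF carr(1,4) mat_equiv_refl D2(1)] equiv1 equiv2 mat_equiv_trans by blast
    moreover have "diagonal_mat ?D"
      using D2(2) D2c carr unfolding diagonal_mat_def by auto
    moreover have "?D $$ (i, i) dvd ?D $$ (j, j)" if "i \<le> j" "j < Suc m" "j < n" for i j
      using that D2(3) D2c a_dvd n
      by (cases i; cases j) (auto simp: A11_def)
    ultimately show ?thesis by blast
  qed
qed

end

section \<open>Invariant factors and their multiplicities\<close>

lemma smith_diagonalI: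
  assumes "mat_equiv A D" "diagonal_mat D"
    and "\<And>i j. i \<le> j \<Longrightarrow> j < dim_row A \<Longrightarrow> j < dim_col A \<Longrightarrow> D $$ (i, i) dvd D $$ (j, j)"
  shows "smith_diagonal A (map (\<lambda>i. D $$ (i, i)) [0..<min (dim_row A) (dim_col A)])"
proof -
  obtain P P' Q Q' where "P \<in> carrier_mat (dim_row A) (dim_row A)" "P' \<in> carrier_mat (dim_row A) (dim_row A)"
    "Q \<in> carrier_mat (dim_col A) (dim_col A)" "Q' \<in> carrier_mat (dim_col A) (dim_col A)"
    "P * P' = 1\<^sub>m (dim_row A)" "P' * P = 1\<^sub>m (dim_row A)"
    "Q * Q' = 1\<^sub>m (dim_col A)" "Q' * Q = 1\<^sub>m (dim_col A)" "D = P * A * Q"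
    using assms(1) unfolding mat_equiv_def by blast
  moreover from this have "invertible_mat P" "invertible_mat Q"
    unfolding invertible_mat_def inverts_mat_def square_mat.simps by (metis carrier_matD)+
  ultimately show ?thesis
    unfolding smith_diagonal_def
    by (intro exI[of _ P] exI[of _ Q] exI[of _ D])
      (use assms(2,3) in \<open>auto simp: sorted_wrt_iff_nth_less\<close>)
qed

lemma smith_diagonalE:
  assumes "smith_diagonal A ds"
  obtains D where "mat_equiv A D" "diagonal_mat D"
    "ds = map (\<lambda>i. D $$ (i, i)) [0..<min (dim_row A) (dim_col A)]"
proof -
  obtain P Q D where *: "P \<in> carrier_mat (dim_row A) (dim_row A)" "invertible_mat P"
    "Q \<in> carrier_mat (dim_col A) (dim_col A)" "invertible_mat Q"
    "D = P * A * Q" "diagonal_mat D" "ds = map (\<lambda>i. D $$ (i, i)) [0..<min (dim_row A) (dim_col A)]"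
    using assms unfolding smith_diagonal_def by blast
  \<comment> \<open>\<open>invertible_mat\<close> does not fix the size of the inverse; comparing
    the column dimensions of both products does.\<close>
  have inv: "\<exists>X'. X' \<in> carrier_mat k k \<and> X * X' = 1\<^sub>m k \<and> X' * X = 1\<^sub>m k"
    if X: "X \<in> carrier_mat k k" "invertible_mat X" for k and X :: "'a mat"
  proof -
    obtain X' where X': "X * X' = 1\<^sub>m (dim_row X)" "X' * X = 1\<^sub>m (dim_row X')"
      using X(2) unfolding invertible_mat_def inverts_mat_def by blast
    have "dim_col X' = k" using arg_cong[OF X'(1), of dim_col] X(1) by simp
    moreover have "dim_row X' = k" using arg_cong[OF X'(2), of dim_col] X(1) by simp
    ultimately show ?thesis using X' X(1) by auto
  qed
  have "mat_equiv A D"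
    unfolding mat_equiv_def using inv[OF *(1,2)] inv[OF *(3,4)] *(1,3,5) by blast
  then show thesis using that * by blast
qed

context uniformizer
begin

text \<open>Existence of a Smith form is what gives the choice behind
  \<open>invariant_factors\<close> its defining property.\<close>

lemma invariant_factorsE:
  fixes A :: "'r mat"
  obtains D where "mat_equiv A D" "diagonal_mat D"
    "invariant_factors A = map (\<lambda>i. D $$ (i, i)) [0..<min (dim_row A) (dim_col A)]"
proof -
  obtain D where "mat_equiv A D \<and> diagonal_mat D \<and>
     (\<forall>i j. i \<le> j \<longrightarrow> j < dim_row A \<longrightarrow> j < dim_col A \<longrightarrow> D $$ (i, i) dvd D $$ (j, j))"
    using smith_form_exists[of A "dim_row A" "dim_col A"] by auto
  then have "smith_diagonal A (map (\<lambda>i. D $$ (i, i)) [0..<min (dim_row A) (dim_col A)])"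
    by (intro smith_diagonalI) auto
  then have "smith_diagonal A (invariant_factors A)"
    unfolding invariant_factors_def by (rule someI)
  then show thesis using smith_diagonalE that by blast
qed

text \<open>Since \<open>B\<close> is any equivalent monomial matrix, multiplicities do not depend
  on the chosen Smith form. The additive shape avoids subtraction on naturals.\<close>

lemma invariant_factor_mult_monomial:
  assumes "mat_equiv A B" "monomial_mat B"
  shows "invariant_factor_mult (\<pi> ^ \<alpha>) A + card (entries_not_dvd (\<pi> ^ \<alpha>) B) = card (entries_not_dvd (\<pi> ^ Suc \<alpha>) B)"
proof -
  obtain D where D: "mat_equiv A D" "diagonal_mat D"
    "invariant_factors A = map (\<lambda>i. D $$ (i, i)) [0..<min (dim_row A) (dim_col A)]"
    using invariant_factorsE .
  have D_dim: "dim_row D = dim_row A" "dim_col D = dim_col A"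
    using mat_equiv_carrier[OF D(1), of "dim_row A" "dim_col A"] by auto
  have card_D: "card (entries_not_dvd a D) = length (filter (\<lambda>d. \<not> a dvd d) (invariant_factors A))" for a
  proof -
    have "entries_not_dvd a D = (\<lambda>i. (i, i)) ` {i. i < length (invariant_factors A) \<and> \<not> a dvd invariant_factors A ! i}"
    proof (rule Set.set_eqI)
      fix x :: "nat \<times> nat"
      obtain i j where x: "x = (i, j)" by (cases x)
      have "D $$ (i, j) = 0" if "i \<noteq> j" "i < dim_row A" "j < dim_col A"
        using D(2) that unfolding diagonal_mat_def D_dim by blast
      then show "x \<in> entries_not_dvd a D
        \<longleftrightarrow> x \<in> (\<lambda>i. (i, i)) ` {i. i < length (invariant_factors A) \<and> \<not> a dvd invariant_factors A ! i}"
        unfolding D(3) entries_not_dvd_def D_dim x by (cases "i = j") (auto simp: image_iff)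
    qed
    then show ?thesis
      by (simp add: card_image inj_on_def length_filter_conv_card)
  qed
  have "length (filter (\<lambda>d. eq_up_to_unit d (\<pi> ^ \<alpha>)) ds) + length (filter (\<lambda>d. \<not> \<pi> ^ \<alpha> dvd d) ds)
    = length (filter (\<lambda>d. \<not> \<pi> ^ Suc \<alpha> dvd d) ds)" for ds
    by (induction ds) (auto simp: eq_up_to_unit_power_iff dest: dvd_mult_right)
  then have "invariant_factor_mult (\<pi> ^ \<alpha>) A + card (entries_not_dvd (\<pi> ^ \<alpha>) D) = card (entries_not_dvd (\<pi> ^ Suc \<alpha>) D)"
    unfolding card_D invariant_factor_mult_def .
  moreover have "mat_equiv D B" using D(1) assms(1) mat_equiv_sym mat_equiv_trans by blast
  ultimately show ?thesis
    using card_entries_not_dvd_eq[OF _ diagonal_imp_monomial_mat[OF D(2)] assms(2)] by metis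
qed

text \<open>Monomial forms of the two blocks combine to a monomial form of \<open>M\<close>, and the
  counts of non-divisible entries add because the zero blocks contribute nothing.\<close>

lemma invariant_factor_mult_block_diag:
  assumes A: "A \<in> carrier_mat m1 n1" and D: "D \<in> carrier_mat m2 n2"
    and "mat_equiv M (four_block_mat A (0\<^sub>m m1 n2) (0\<^sub>m m2 n1) D)"
  shows "invariant_factor_mult (\<pi> ^ \<alpha>) M = invariant_factor_mult (\<pi> ^ \<alpha>) A + invariant_factor_mult (\<pi> ^ \<alpha>) D"
proof -
  obtain A' where A': "mat_equiv A A'" "monomial_mat A'"
    using invariant_factorsE diagonal_imp_monomial_mat by metis
  obtain D' where D': "mat_equiv D D'" "monomial_mat D'"
    using invariant_factorsE diagonal_imp_monomial_mat by metis
  have carr: "A' \<in> carrier_mat m1 n1" "D' \<in> carrier_mat m2 n2"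
    using mat_equiv_carrier A D A'(1) D'(1) by blast+
  have "mat_equiv M (four_block_mat A' (0\<^sub>m m1 n2) (0\<^sub>m m2 n1) D')"
    using mat_equiv_block_diag[OF A D A'(1) D'(1)] assms(3) mat_equiv_trans by blast
  from invariant_factor_mult_monomial[OF this monomial_mat_block_diag[OF A'(2) D'(2) carr], of \<alpha>]
    invariant_factor_mult_monomial[OF A', of \<alpha>] invariant_factor_mult_monomial[OF D', of \<alpha>]
  show ?thesis by (simp add: card_entries_not_dvd_block_diag[OF carr])
qed

text \<open>Conjugating \<open>C * A\<close> by \<open>Q\<close> gives
  \<open>(Q' * C * P') * D = \<pi>^e I\<close>. Column \<open>i\<close> of \<open>D\<close> contains
  only its diagonal entry, so the \<open>(i, i)\<close> entry of the product is a multiple of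
  \<open>d\<close>.\<close>

lemma invariant_factor_dvd_power:
  assumes A: "A \<in> carrier_mat m n" and C: "C \<in> carrier_mat n m"
    and CA: "C * A = \<pi> ^ e \<cdot>\<^sub>m 1\<^sub>m n" and d: "d \<in> set (invariant_factors A)"
  shows "\<exists>\<alpha> \<le> e. eq_up_to_unit d (\<pi> ^ \<alpha>)"
proof -
  obtain D where D: "mat_equiv A D" "diagonal_mat D"
    "invariant_factors A = map (\<lambda>i. D $$ (i, i)) [0..<min (dim_row A) (dim_col A)]"
    using invariant_factorsE .
  have Dc: "D \<in> carrier_mat m n" using mat_equiv_carrier[OF D(1) A] .
  obtain P P' Q Q' where *: "P \<in> carrier_mat m m" "P' \<in> carrier_mat m m"
    "Q \<in> carrier_mat n n" "Q' \<in> carrier_mat n n"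
    "P * P' = 1\<^sub>m m" "P' * P = 1\<^sub>m m" "Q * Q' = 1\<^sub>m n" "Q' * Q = 1\<^sub>m n" "D = P * A * Q"
    using mat_equivE[OF D(1) A] .
  obtain i where i: "i < m" "i < n" "d = D $$ (i, i)" using d D(3) A by auto
  have "(Q' * C * P') * D = Q' * C * (P' * P) * A * Q"
    unfolding *(9) using *(1-4) A C by (simp add: assoc_mult_mat[of _ n m _ m _ n]
      assoc_mult_mat[of _ n m _ n _ n] assoc_mult_mat[of _ n n _ n _ n] assoc_mult_mat[of _ n n _ m _ n]
       assoc_mult_mat[of _ n n _ m _ m] assoc_mult_mat[of _ m m _ n _ n] assoc_mult_mat[of _ n m _ m _ m] assoc_mult_mat[of _ m m _ m _ n])
  also have "\<dots> = Q' * (C * A) * Q"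
    unfolding *(6) using *(1-4) A C by (simp add: right_mult_one_mat[of _ n m] assoc_mult_mat[of _ n n _ m _ n] assoc_mult_mat[of _ n m _ n _ n])
  also have "\<dots> = \<pi> ^ e \<cdot>\<^sub>m 1\<^sub>m n"
    unfolding CA using *(3,4,8) by (simp add: mult_smult_distrib[of _ n n _ n] mult_smult_assoc_mat[of _ n n _ n])
  finally have "((Q' * C * P') * D) $$ (i, i) = \<pi> ^ e" using i by simp
  moreover have "((Q' * C * P') * D) $$ (i, i) = (\<Sum>l = 0..<m. (Q' * C * P') $$ (i, l) * D $$ (l, i))"
    by (rule mult_mat_index[of _ n m _ n]) (use * C Dc i in auto)
  moreover have "d dvd D $$ (l, i)" if "l < m" for l
    using D(2) i that Dc unfolding diagonal_mat_def by (cases "l = i") auto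
  ultimately have dvd: "d dvd \<pi> ^ e" by (metis (no_types, lifting) atLeastLessThan_iff dvd_mult dvd_sum)
  then have "d \<noteq> 0" using power_nonzero by auto
  then obtain u \<alpha> where u: "u dvd 1" "d = u * \<pi> ^ \<alpha>" using decompose by blast
  have "\<alpha> \<le> e"
  proof (rule ccontr)
    assume "\<not> \<alpha> \<le> e"
    then have "\<pi> ^ Suc e dvd \<pi> ^ \<alpha>" by (intro le_imp_power_dvd) simp
    with dvd u have "\<pi> ^ Suc e dvd \<pi> ^ e" by (meson dvd_mult dvd_trans)
    with power_Suc_not_dvd show False by blast
  qed
  with u show ?thesis unfolding eq_up_to_unit_def by blast
qed

end

section \<open>Subspaces over a finite field\<close>

text \<open>Subspaces without the module record, so that closure properties are plain set
  membership; \<open>subspaces_iff\<close> is the bridge.\<close>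

definition linear_set :: "nat \<Rightarrow> 'q :: field vec set \<Rightarrow> bool" where
  "linear_set d W \<longleftrightarrow> W \<subseteq> carrier_vec d \<and> 0\<^sub>v d \<in> W \<and> (\<forall>u\<in>W. \<forall>v\<in>W. u + v \<in> W) \<and> (\<forall>c. \<forall>v\<in>W. c \<cdot>\<^sub>v v \<in> W)"

lemma linear_setD:
  assumes "linear_set d W"
  shows linear_set_carrier: "v \<in> W \<Longrightarrow> v \<in> carrier_vec d"
    and linear_set_zero: "0\<^sub>v d \<in> W"
    and linear_set_add: "u \<in> W \<Longrightarrow> v \<in> W \<Longrightarrow> u + v \<in> W"
    and linear_set_smult: "v \<in> W \<Longrightarrow> c \<cdot>\<^sub>v v \<in> W"
  using assms by (simp_all add: linear_set_def subset_eq)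

lemma linear_set_diff:
  assumes "linear_set d W" "u \<in> W" "v \<in> W"
  shows "u - v \<in> W"
proof -
  have "u - v = u + (- 1) \<cdot>\<^sub>v v"
    using assms(2,3)[THEN linear_set_carrier[OF assms(1)]] by (intro eq_vecI) simp_all
  then show ?thesis using linear_set_add[OF assms(1,2)] linear_set_smult[OF assms(1,3)] by simp
qed

lemma linear_set_smult_cancel:
  assumes "linear_set d W" "c \<cdot>\<^sub>v v \<in> W" "c \<noteq> 0"
  shows "v \<in> W"
proof -
  have "v = inverse c \<cdot>\<^sub>v (c \<cdot>\<^sub>v v)" using assms(3) by (simp add: smult_smult_assoc)
  then show ?thesis using linear_set_smult[OF assms(1,2)] by metis
qed

lemma linear_set_add_cancel:
  assumes "linear_set d W" "w \<in> W" "v \<in> carrier_vec d" "w + v \<in> W \<or> v + w \<in> W"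
  shows "v \<in> W"
proof -
  have "w \<in> carrier_vec d" using linear_set_carrier[OF assms(1,2)] .
  then have "(w + v) - w = v" "(v + w) - w = v"
    using assms(3) by (auto intro!: eq_vecI)
  with assms(4) show ?thesis
    using linear_set_diff[OF assms(1) _ assms(2), of "w + v"] linear_set_diff[OF assms(1) _ assms(2), of "v + w"] by auto
qed

lemma linear_set_zero_singleton: "linear_set d {0\<^sub>v d}"
  unfolding linear_set_def by auto

lemma carrier_vec_eq_image: "carrier_vec d = vec_of_list ` {xs. set xs \<subseteq> UNIV \<and> length xs = d}"
proof (intro equalityI subsetI)
  fix v :: "'q vec" assume "v \<in> carrier_vec d"
  then have "v = vec_of_list (list_of_vec v)" "length (list_of_vec v) = d" by (auto simp: vec_list)
  then show "v \<in> vec_of_list ` {xs. set xs \<subseteq> UNIV \<and> length xs = d}" by blast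
next
  fix v :: "'q vec" assume "v \<in> vec_of_list ` {xs. set xs \<subseteq> UNIV \<and> length xs = d}"
  then show "v \<in> carrier_vec d" by (metis (mono_tags, lifting) carrier_vecI dim_vec_of_list imageE mem_Collect_eq)
qed

lemma finite_carrier_vec: "finite (carrier_vec d :: 'q :: finite vec set)"
  unfolding carrier_vec_eq_image using finite_lists_length_eq[of "UNIV :: 'q set" d] by simp

lemma card_carrier_vec: "card (carrier_vec d :: 'q :: finite vec set) = CARD('q) ^ d"
proof -
  have "inj_on vec_of_list {xs :: 'q list. set xs \<subseteq> UNIV \<and> length xs = d}"
    by (metis inj_onI list_vec)
  then show ?thesis
    unfolding carrier_vec_eq_image using card_lists_length_eq[of "UNIV :: 'q set" d] by (simp add: card_image)
qed

lemma finite_linear_set: "linear_set d W \<Longrightarrow> finite (W :: 'q :: {field, finite} vec set)"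
  unfolding linear_set_def using finite_carrier_vec finite_subset by blast

text \<open>Coordinates in a finite basis identify the space with the functions from the basis to
  the field.\<close>

lemma (in vectorspace) card_carrier:
  assumes "finite (carrier V)"
  shows "card (carrier V) = card (carrier K) ^ dim"
proof -
  have "gen_set (carrier V)"
    using in_own_span[of "carrier V"] span_is_subset2[of "carrier V"] by blast
  then have "fin_dim" unfolding fin_dim_def using assms by blast
  then obtain \<beta> where \<beta>: "finite \<beta>" "basis \<beta>" using finite_basis_exists by blast
  then have sub: "\<beta> \<subseteq> carrier V" unfolding basis_def by blast
  have uniq: "\<forall>v. v \<in> carrier V \<longrightarrow> (\<exists>!a. a \<in> \<beta> \<rightarrow>\<^sub>E carrier K \<and> lincomb a \<beta> = v)"
    using basis_criterion[OF \<beta>(1) sub] \<beta>(2) by blast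
  have "lincomb a \<beta> \<in> carrier V" if "a \<in> \<beta> \<rightarrow>\<^sub>E carrier K" for a
    using that sub by (intro lincomb_closed) (auto simp: PiE_def)
  then have "bij_betw (\<lambda>a. lincomb a \<beta>) (\<beta> \<rightarrow>\<^sub>E carrier K) (carrier V)"
    using uniq unfolding bij_betw_def inj_on_def image_def by blast
  then have "card (carrier V) = card (\<beta> \<rightarrow>\<^sub>E carrier K)" by (simp add: bij_betw_same_card)
  then show ?thesis using \<beta> dim_basis by (simp add: card_PiE)
qed

lemma CARD_field_gt_1: "CARD('q :: {field, finite}) > 1"
proof -
  have "card {0, 1 :: 'q} \<le> CARD('q)" by (intro card_mono) auto
  then show ?thesis by simp
qed

text \<open>Over a finite field the cardinality determines the dimension, which turns the dimension
  arguments below into comparisons of finite sets.\<close>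

lemma subspaces_iff:
  "(W :: 'q :: {field, finite} vec set) \<in> subspaces d k \<longleftrightarrow> linear_set d W \<and> card W = CARD('q) ^ k"
proof -
  interpret vec_space "TYPE('q)" d .
  have eq: "subspace class_ring W V \<longleftrightarrow> linear_set d W"
    unfolding subspace_def submodule_def linear_set_def
    using vectorspace_axioms module_axioms by (auto simp: class_ring_simps)
  have "card W = CARD('q) ^ vectorspace.dim class_ring (V\<lparr>carrier := W\<rparr>)" if W: "linear_set d W"
  proof -
    interpret W: vectorspace class_ring "V\<lparr>carrier := W\<rparr>"
      by (rule subspace_is_vs[OF iffD2[OF eq W]])
    show ?thesis using W.card_carrier finite_linear_set[OF W] by simp
  qed
  then show ?thesis
    unfolding subspaces_def using eq CARD_field_gt_1[where ?'q = 'q] by (auto simp: power_inject_exp)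
qed

lemma finite_subspaces: "finite (subspaces d k :: 'q :: {field, finite} vec set set)"
  by (rule finite_subset[of _ "Pow (carrier_vec d)"])
    (auto simp: subspaces_iff linear_set_def finite_carrier_vec)

lemma subspaces_linear_set: "(W :: 'q :: {field, finite} vec set) \<in> subspaces d k \<Longrightarrow> linear_set d W"
  by (simp add: subspaces_iff)

text \<open>For linear \<open>W\<close> this is the span of \<open>W\<close> and \<open>v\<close>.
  Pencils of flats and cones over flats are both built from it.\<close>

definition adjoin :: "'q :: field vec set \<Rightarrow> 'q vec \<Rightarrow> 'q vec set" where
  "adjoin W v = {w + c \<cdot>\<^sub>v v | w c. w \<in> W}"

lemma adjoinI: "w \<in> W \<Longrightarrow> x = w + c \<cdot>\<^sub>v v \<Longrightarrow> x \<in> adjoin W v"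
  unfolding adjoin_def by blast

lemma adjoin_iff:
  assumes W: "linear_set d W" and v: "v \<in> carrier_vec d" and x: "x \<in> carrier_vec d"
  shows "x \<in> adjoin W v \<longleftrightarrow> (\<exists>c. x - c \<cdot>\<^sub>v v \<in> W)"
proof
  assume "x \<in> adjoin W v"
  then obtain w c where w: "w \<in> W" "x = w + c \<cdot>\<^sub>v v" unfolding adjoin_def by blast
  then have "x - c \<cdot>\<^sub>v v = w"
    using v linear_set_carrier[OF W w(1)] by (intro eq_vecI; simp)
  then show "\<exists>c. x - c \<cdot>\<^sub>v v \<in> W" using w by metis
next
  assume "\<exists>c. x - c \<cdot>\<^sub>v v \<in> W"
  then obtain c where "x - c \<cdot>\<^sub>v v \<in> W" ..
  moreover have "x = (x - c \<cdot>\<^sub>v v) + c \<cdot>\<^sub>v v"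
    using v x by (intro eq_vecI; simp)
  ultimately show "x \<in> adjoin W v" by (rule adjoinI)
qed

lemma adjoin_superset:
  assumes W: "linear_set d W" and v: "v \<in> carrier_vec d"
  shows "W \<subseteq> adjoin W v" "v \<in> adjoin W v"
proof -
  show "W \<subseteq> adjoin W v"
  proof
    fix w assume w: "w \<in> W"
    have "w = w + 0 \<cdot>\<^sub>v v"
      using v linear_set_carrier[OF W w] by (intro eq_vecI; simp)
    with w show "w \<in> adjoin W v" by (rule adjoinI)
  qed
  have "v = 0\<^sub>v d + 1 \<cdot>\<^sub>v v" using v by simp
  with linear_set_zero[OF W] show "v \<in> adjoin W v" by (rule adjoinI)
qed

lemma linear_set_adjoin:
  assumes W: "linear_set d W" and v: "v \<in> carrier_vec d"
  shows "linear_set d (adjoin W v)"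
  unfolding linear_set_def
proof (intro conjI ballI allI)
  show "adjoin W v \<subseteq> carrier_vec d"
    using v linear_set_carrier[OF W] by (auto simp: adjoin_def)
  show "0\<^sub>v d \<in> adjoin W v" using adjoin_superset[OF W v] linear_set_zero[OF W] by blast
next
  fix x y assume "x \<in> adjoin W v" "y \<in> adjoin W v"
  then obtain w c w' c' where *: "w \<in> W" "x = w + c \<cdot>\<^sub>v v" "w' \<in> W" "y = w' + c' \<cdot>\<^sub>v v"
    unfolding adjoin_def by blast
  have "x + y = (w + w') + (c + c') \<cdot>\<^sub>v v"
    using * v linear_set_carrier[OF W *(1)] linear_set_carrier[OF W *(3)]
    by (intro eq_vecI; simp add: algebra_simps)
  with linear_set_add[OF W *(1,3)] show "x + y \<in> adjoin W v" by (rule adjoinI)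
next
  fix a x assume "x \<in> adjoin W v"
  then obtain w c where *: "w \<in> W" "x = w + c \<cdot>\<^sub>v v" unfolding adjoin_def by blast
  have "a \<cdot>\<^sub>v x = a \<cdot>\<^sub>v w + (a * c) \<cdot>\<^sub>v v"
    using * v linear_set_carrier[OF W *(1)] by (intro eq_vecI; simp add: algebra_simps)
  with linear_set_smult[OF W *(1)] show "a \<cdot>\<^sub>v x \<in> adjoin W v" by (rule adjoinI)
qed

lemma adjoin_coeff_unique:
  assumes W: "linear_set d W" and v: "v \<in> carrier_vec d" "v \<notin> W"
    and "x \<in> carrier_vec d" "x - a \<cdot>\<^sub>v v \<in> W" "x - b \<cdot>\<^sub>v v \<in> W"
  shows "a = b"
proof (rule ccontr)
  assume "a \<noteq> b"
  have "(x - a \<cdot>\<^sub>v v) - (x - b \<cdot>\<^sub>v v) = (b - a) \<cdot>\<^sub>v v"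
    using assms by (intro eq_vecI; simp add: algebra_simps)
  then have "(b - a) \<cdot>\<^sub>v v \<in> W" using linear_set_diff[OF W assms(5,6)] by simp
  then show False using linear_set_smult_cancel[OF W] \<open>a \<noteq> b\<close> v by auto
qed

lemma card_adjoin:
  fixes W :: "'q :: {field, finite} vec set"
  assumes W: "linear_set d W" and v: "v \<in> carrier_vec d" "v \<notin> W"
  shows "card (adjoin W v) = CARD('q) * card W"
proof -
  have eq: "adjoin W v = (\<lambda>(c, w). w + c \<cdot>\<^sub>v v) ` (UNIV \<times> W)"
    unfolding adjoin_def by auto
  have "inj_on (\<lambda>(c, w). w + c \<cdot>\<^sub>v v) (UNIV \<times> W)"
  proof (rule inj_onI, clarify)
    fix a b w w' assume w: "w \<in> W" "w' \<in> W" and eq: "w + a \<cdot>\<^sub>v v = w' + b \<cdot>\<^sub>v v"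
    have c: "w \<in> carrier_vec d" "w' \<in> carrier_vec d" using w linear_set_carrier[OF W] by auto
    have "w + a \<cdot>\<^sub>v v - a \<cdot>\<^sub>v v = w" "w' + b \<cdot>\<^sub>v v - b \<cdot>\<^sub>v v = w'"
      using c v by (auto intro!: eq_vecI)
    then have *: "w + a \<cdot>\<^sub>v v - a \<cdot>\<^sub>v v = w" "w + a \<cdot>\<^sub>v v - b \<cdot>\<^sub>v v = w'"
      unfolding eq by simp_all
    have "a = b"
      by (rule adjoin_coeff_unique[OF W v, of "w + a \<cdot>\<^sub>v v"]) (use * w c v in auto)
    with * show "a = b \<and> w = w'" by metis
  qed
  then show ?thesis unfolding eq by (simp add: card_image card_cartesian_product)
qed

lemma adjoin_subspaces:
  fixes W :: "'q :: {field, finite} vec set"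
  assumes "W \<in> subspaces d k" "v \<in> carrier_vec d" "v \<notin> W"
  shows "adjoin W v \<in> subspaces d (Suc k)"
  using assms linear_set_adjoin[of d W v] card_adjoin[of d W v] by (auto simp: subspaces_iff)

lemma adjoin_least:
  assumes "linear_set d Z" "W \<subseteq> Z" "v \<in> Z"
  shows "adjoin W v \<subseteq> Z"
  using assms linear_set_add[OF assms(1)] linear_set_smult[OF assms(1)] by (auto simp: adjoin_def)

text \<open>\<open>adjoin W v\<close> lies in \<open>Z\<close> and has as many elements. Hence the
  \<open>(k+1)\<close>-dimensional superspaces of \<open>W\<close> partition the vectors outside
  \<open>W\<close>.\<close>

lemma subspaces_Suc_eq_adjoin:
  fixes W :: "'q :: {field, finite} vec set"
  assumes W: "W \<in> subspaces d k" and Z: "Z \<in> subspaces d (Suc k)" "W \<subseteq> Z" and v: "v \<in> Z" "v \<notin> W"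
  shows "Z = adjoin W v"
proof -
  have Zl: "linear_set d Z" using Z by (simp add: subspaces_iff)
  have "adjoin W v \<in> subspaces d (Suc k)"
    using adjoin_subspaces[OF W _ v(2)] linear_set_carrier[OF Zl v(1)] .
  then have "card (adjoin W v) = card Z" using Z by (simp add: subspaces_iff)
  with adjoin_least[OF Zl Z(2) v(1)] finite_linear_set[OF Zl] show ?thesis
    using card_subset_eq by metis
qed

lemma subspaces_0: "subspaces d 0 = {{0\<^sub>v d :: 'q :: {field, finite} vec}}"
proof -
  have *: "W = {0\<^sub>v d}" if "linear_set d W" "card W = 1" for W :: "'q vec set"
    using that linear_set_zero[OF that(1)] by (metis card_1_singletonE singletonD)
  have "linear_set d W \<and> card W = 1 \<longleftrightarrow> W = {0\<^sub>v d}" for W :: "'q vec set"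
    by (intro iffI conjI) (erule conjE, erule (1) *, simp_all add: linear_set_zero_singleton)
  then show ?thesis
    by (intro equalityI subsetI) (simp_all only: subspaces_iff power_0 singleton_iff)
qed

lemma line_eq_adjoin:
  fixes L :: "'q :: {field, finite} vec set"
  assumes "L \<in> subspaces d 1" "v \<in> L" "v \<noteq> 0\<^sub>v d"
  shows "L = adjoin {0\<^sub>v d} v"
  using subspaces_Suc_eq_adjoin[of "{0\<^sub>v d}" d 0 L v] assms linear_set_zero[of d L]
  by (simp add: subspaces_0 subspaces_iff)

lemma line_subset_iff:
  fixes L :: "'q :: {field, finite} vec set"
  assumes "L \<in> subspaces d 1" "v \<in> L" "v \<noteq> 0\<^sub>v d" "linear_set d Z"
  shows "L \<subseteq> Z \<longleftrightarrow> v \<in> Z"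
  using line_eq_adjoin[OF assms(1-3)] adjoin_least[OF assms(4), of "{0\<^sub>v d}" v] linear_set_zero[OF assms(4)] assms(2)
  by auto

lemma carrier_in_subspaces: "(carrier_vec d :: 'q :: {field, finite} vec set) \<in> subspaces d d"
  by (auto simp: subspaces_iff linear_set_def card_carrier_vec)

lemma exists_not_in_subspace:
  fixes W :: "'q :: {field, finite} vec set"
  assumes "W \<in> subspaces d k" "k < d"
  obtains v where "v \<in> carrier_vec d" "v \<notin> W"
proof -
  have "card W < card (carrier_vec d :: 'q vec set)"
    using assms carrier_in_subspaces[of d, where ?'q = 'q] CARD_field_gt_1[where ?'q = 'q]
    by (simp add: subspaces_iff power_strict_increasing)
  then have "\<not> carrier_vec d \<subseteq> W"
    using card_mono[OF finite_linear_set[OF subspaces_linear_set[OF assms(1)]], of "carrier_vec d"] by linarith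
  then show thesis using that by blast
qed

text \<open>The vectors outside \<open>W\<close> fall into classes \<open>Z - W\<close> of size
  \<open>q^(k+1) - q^k\<close>; there are \<open>q^d - q^k\<close> such vectors, and the quotient is
  a geometric sum.\<close>

lemma card_superspaces:
  fixes W :: "'q :: {field, finite} vec set"
  assumes W: "W \<in> subspaces d k" and k: "k < d"
  shows "card {Z \<in> subspaces d (Suc k). W \<subseteq> Z} = (\<Sum>i<d - k. CARD('q) ^ i)"
proof -
  let ?q = "CARD('q)" and ?S = "{Z \<in> subspaces d (Suc k). W \<subseteq> Z}"
  have Wl: "linear_set d W" using W by (simp add: subspaces_iff)
  have fin: "finite W" using finite_linear_set[OF Wl] .
  have "carrier_vec d - W = (\<Union>Z\<in>?S. Z - W)"
  proof (intro equalityI subsetI)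
    fix v assume "v \<in> carrier_vec d - W"
    then show "v \<in> (\<Union>Z\<in>?S. Z - W)"
      using adjoin_subspaces[OF W, of v] adjoin_superset[OF Wl, of v] by blast
  qed (auto dest: subspaces_linear_set linear_set_carrier)
  then have "card (carrier_vec d - W) = card (\<Union>Z\<in>?S. Z - W)" by simp
  also have "\<dots> = (\<Sum>Z\<in>?S. card (Z - W))"
  proof (rule card_UN_disjoint)
    show "finite ?S" using finite_subspaces[of d "Suc k", where ?'q = 'q] by simp
    show "\<forall>Z\<in>?S. finite (Z - W)" by (auto intro: finite_linear_set subspaces_linear_set)
    show "\<forall>Z\<in>?S. \<forall>Z'\<in>?S. Z \<noteq> Z' \<longrightarrow> (Z - W) \<inter> (Z' - W) = {}"
      using subspaces_Suc_eq_adjoin[OF W] by blast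
  qed
  also have "\<dots> = (\<Sum>Z\<in>?S. ?q ^ Suc k - ?q ^ k)"
    by (rule sum.cong) (use W fin in \<open>auto simp: card_Diff_subset subspaces_iff\<close>)
  finally have "card (carrier_vec d - W) = card ?S * (?q ^ Suc k - ?q ^ k)" by simp
  moreover have "card (carrier_vec d - W) = ?q ^ d - ?q ^ k"
    using carrier_in_subspaces[of d, where ?'q = 'q] W fin Wl
    by (subst card_Diff_subset) (auto simp: subspaces_iff linear_set_def)
  ultimately have "int (card ?S) * (int ?q ^ Suc k - int ?q ^ k) = int ?q ^ d - int ?q ^ k"
    using k CARD_field_gt_1[where ?'q = 'q] by (metis (no_types, lifting) One_nat_def lessI less_imp_le_nat of_nat_diff of_nat_mult of_nat_power power_increasing)
  moreover have "int ?q ^ d = int ?q ^ k * int ?q ^ (d - k)"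
    using k by (simp flip: power_add)
  ultimately have "int ?q ^ k * (int (card ?S) * (int ?q - 1)) = int ?q ^ k * (int ?q ^ (d - k) - 1)"
    by (simp add: algebra_simps)
  then have "int (card ?S) * (int ?q - 1) = int ?q ^ (d - k) - 1" by simp
  also have "\<dots> = (\<Sum>i<d - k. int ?q ^ i) * (int ?q - 1)"
    using power_diff_1_eq[of "int ?q" "d - k"] by (simp add: mult.commute)
  finally have "int (card ?S) = (\<Sum>i<d - k. int ?q ^ i)"
    using CARD_field_gt_1[where ?'q = 'q] by simp
  then show ?thesis by (metis (mono_tags, lifting) of_nat_eq_iff of_nat_power of_nat_sum sum.cong)
qed

section \<open>Flats\<close>

text \<open>For a flat \<open>v + W\<close> this recovers \<open>W\<close> without choosing a base
  point.\<close>

definition direction :: "'q :: field vec set \<Rightarrow> 'q vec set" where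
  "direction F = {x - y | x y. x \<in> F \<and> y \<in> F}"

lemma mem_translate_iff:
  assumes W: "linear_set d W" and v: "v \<in> carrier_vec d" and x: "x \<in> carrier_vec d"
  shows "x \<in> (\<lambda>w. v + w) ` W \<longleftrightarrow> x - v \<in> W"
proof
  assume "x \<in> (\<lambda>w. v + w) ` W"
  then obtain w where w: "w \<in> W" "x = v + w" by blast
  then have "x - v = w" using v linear_set_carrier[OF W w(1)] by (auto intro!: eq_vecI)
  with w show "x - v \<in> W" by simp
next
  assume "x - v \<in> W"
  moreover have "x = v + (x - v)" using v x by (intro eq_vecI) auto
  ultimately show "x \<in> (\<lambda>w. v + w) ` W" by (metis imageI)
qed

lemma direction_translate:
  assumes W: "linear_set d W" and v: "v \<in> carrier_vec d"
  shows "direction ((\<lambda>w. v + w) ` W) = W"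
proof (intro equalityI subsetI)
  fix x assume "x \<in> direction ((\<lambda>w. v + w) ` W)"
  then obtain w w' where w: "w \<in> W" "w' \<in> W" "x = (v + w) - (v + w')"
    unfolding direction_def by blast
  then have "x = w - w'"
    using v linear_set_carrier[OF W w(1)] linear_set_carrier[OF W w(2)] by (intro eq_vecI) auto
  then show "x \<in> W" using linear_set_diff[OF W w(1,2)] by simp
next
  fix w assume w: "w \<in> W"
  then have "w = (v + w) - (v + 0\<^sub>v d)"
    using v linear_set_carrier[OF W w] by (intro eq_vecI) auto
  then show "w \<in> direction ((\<lambda>w. v + w) ` W)"
    unfolding direction_def using w linear_set_zero[OF W] by blast
qed

lemma translate_in_flats:
  "W \<in> subspaces d k \<Longrightarrow> v \<in> carrier_vec d \<Longrightarrow> (\<lambda>w. v + w) ` W \<in> flats d k"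
  unfolding flats_def by blast

context
  fixes F :: "'q :: {field, finite} vec set" and d k :: nat
  assumes F: "F \<in> flats d k"
begin

lemma flat_direction: "direction F \<in> subspaces d k"
proof -
  obtain v W where *: "F = (\<lambda>w. v + w) ` W" "v \<in> carrier_vec d" "W \<in> subspaces d k"
    using F unfolding flats_def by blast
  then show ?thesis using direction_translate[OF subspaces_linear_set[OF *(3)] *(2)] by simp
qed

lemma flat_subset: "F \<subseteq> carrier_vec d"
proof -
  obtain v W where *: "F = (\<lambda>w. v + w) ` W" "v \<in> carrier_vec d" "W \<in> subspaces d k"
    using F unfolding flats_def by blast
  then show ?thesis using linear_set_carrier[OF subspaces_linear_set[OF *(3)]] by auto
qed

lemma flat_nonempty: "F \<noteq> {}"
  using F linear_set_zero[OF subspaces_linear_set] unfolding flats_def by blast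

lemma flat_mem_iff:
  assumes "v \<in> F" "x \<in> carrier_vec d"
  shows "x \<in> F \<longleftrightarrow> x - v \<in> direction F"
proof
  assume "x \<in> F"
  with assms show "x - v \<in> direction F" unfolding direction_def by blast
next
  assume x: "x - v \<in> direction F"
  obtain u W where *: "F = (\<lambda>w. u + w) ` W" "u \<in> carrier_vec d" "W \<in> subspaces d k"
    using F unfolding flats_def by blast
  have W: "linear_set d W" using subspaces_linear_set[OF *(3)] .
  have eq: "direction F = W" using direction_translate[OF W *(2)] * by simp
  have v: "v \<in> carrier_vec d" using assms flat_subset by blast
  have "v - u \<in> W" using assms(1) mem_translate_iff[OF W *(2) v] * by simp
  then have "(x - v) + (v - u) \<in> W" using x linear_set_add[OF W] unfolding eq by blast
  moreover have "(x - v) + (v - u) = x - u" using v *(2) assms(2) by (intro eq_vecI) auto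
  ultimately show "x \<in> F" using mem_translate_iff[OF W *(2) assms(2)] * by simp
qed

lemma flat_eq_translate:
  assumes v: "v \<in> F"
  shows "F = (\<lambda>w. v + w) ` direction F"
proof (rule Set.set_eqI)
  fix x :: "'q vec"
  have lin: "linear_set d (direction F)" using subspaces_linear_set[OF flat_direction] .
  have vc: "v \<in> carrier_vec d" using v flat_subset by blast
  show "x \<in> F \<longleftrightarrow> x \<in> (\<lambda>w. v + w) ` direction F"
  proof (cases "x \<in> carrier_vec d")
    case True
    show ?thesis using flat_mem_iff[OF v True] mem_translate_iff[OF lin vc True] by simp
  next
    case False
    then have "x \<notin> F" using flat_subset by blast
    moreover have "v + w \<in> carrier_vec d" if "w \<in> direction F" for w
      using linear_set_carrier[OF lin that] vc by simp
    ultimately show ?thesis using False by blast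
  qed
qed

lemma flat_with_zero:
  assumes "0\<^sub>v d \<in> F"
  shows "direction F = F"
proof (rule Set.set_eqI)
  fix x :: "'q vec"
  have "x \<in> carrier_vec d \<Longrightarrow> x - 0\<^sub>v d = x" by (intro eq_vecI) auto
  then show "x \<in> direction F \<longleftrightarrow> x \<in> F"
    using flat_mem_iff[OF assms, of x] flat_subset linear_set_carrier[OF subspaces_linear_set[OF flat_direction], of x]
    by auto
qed

lemma flat_subset_linear_iff:
  assumes v: "v \<in> F" and Z: "linear_set d Z"
  shows "F \<subseteq> Z \<longleftrightarrow> direction F \<subseteq> Z \<and> v \<in> Z"
proof
  assume "F \<subseteq> Z"
  with v show "direction F \<subseteq> Z \<and> v \<in> Z" using linear_set_diff[OF Z] unfolding direction_def by blast
next
  assume "direction F \<subseteq> Z \<and> v \<in> Z"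
  then have "(\<lambda>w. v + w) ` direction F \<subseteq> Z" using linear_set_add[OF Z] by blast
  then show "F \<subseteq> Z" using flat_eq_translate[OF v] by simp
qed

lemma flat_zero_iff: "v \<in> F \<Longrightarrow> 0\<^sub>v d \<in> F \<longleftrightarrow> v \<in> direction F"
proof -
  assume v: "v \<in> F"
  then have vc: "v \<in> carrier_vec d" using flat_subset by blast
  have lin: "linear_set d (direction F)" using subspaces_linear_set[OF flat_direction] .
  have "0\<^sub>v d \<in> F \<longleftrightarrow> 0\<^sub>v d - v \<in> direction F"
    using flat_mem_iff[OF v] by simp
  also have "0\<^sub>v d - v = (- 1) \<cdot>\<^sub>v v" using vc by (intro eq_vecI) auto
  also have "(- 1) \<cdot>\<^sub>v v \<in> direction F \<longleftrightarrow> v \<in> direction F"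
    using linear_set_smult_cancel[OF lin, of "- 1" v] linear_set_smult[OF lin] by auto
  finally show ?thesis .
qed

end

lemma finite_flats: "finite (flats d k :: 'q :: {field, finite} vec set set)"
  by (rule finite_subset[of _ "Pow (carrier_vec d)"])
    (use flat_subset in \<open>auto simp: finite_carrier_vec\<close>)

section \<open>Counts for a flat and a line through the origin\<close>

lemma card_line:
  "(L :: 'q :: {field, finite} vec set) \<in> subspaces d 1 \<Longrightarrow> card L = CARD('q)"
  by (simp add: subspaces_iff)

text \<open>If \<open>F\<close> contains the origin, it equals its direction, and the subspaces
  sought are its superspaces containing \<open>L\<close>. If not, \<open>F\<close> already spans an
  \<open>(r+1)\<close>-dimensional space, and a line of that space meets \<open>F\<close> exactly
  when it is not in the direction.\<close>

lemma card_flat_line_superspaces: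
  fixes F :: "'q :: {field, finite} vec set"
  assumes F: "F \<in> flats n r" and L: "L \<in> subspaces n 1" and r: "r + 2 \<le> n"
  shows "0\<^sub>v n \<in> F \<Longrightarrow> L \<subseteq> direction F \<Longrightarrow> card (F \<inter> L) = CARD('q) \<and>
      card {Z \<in> subspaces n (Suc r). F \<subseteq> Z \<and> L \<subseteq> Z} = 1 + CARD('q) * (\<Sum>i<n - r - 1. CARD('q) ^ i)"
    and "0\<^sub>v n \<in> F \<Longrightarrow> \<not> L \<subseteq> direction F \<Longrightarrow> card (F \<inter> L) = 1 \<and>
      card {Z \<in> subspaces n (Suc r). F \<subseteq> Z \<and> L \<subseteq> Z} = 1"
    and "0\<^sub>v n \<notin> F \<Longrightarrow> L \<subseteq> direction F \<Longrightarrow> card (F \<inter> L) = 0 \<and>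
      card {Z \<in> subspaces n (Suc r). F \<subseteq> Z \<and> L \<subseteq> Z} = 1"
    and "0\<^sub>v n \<notin> F \<Longrightarrow> \<not> L \<subseteq> direction F \<Longrightarrow>
      card (F \<inter> L) = card {Z \<in> subspaces n (Suc r). F \<subseteq> Z \<and> L \<subseteq> Z}"
proof -
  let ?W = "direction F" and ?S = "{Z \<in> subspaces n (Suc r). F \<subseteq> Z \<and> L \<subseteq> Z}"
  have W: "?W \<in> subspaces n r" using flat_direction[OF F] .
  have Wl: "linear_set n ?W" and Ll: "linear_set n L" using subspaces_linear_set W L by auto
  show "card (F \<inter> L) = CARD('q) \<and> card ?S = 1 + CARD('q) * (\<Sum>i<n - r - 1. CARD('q) ^ i)"
    if "0\<^sub>v n \<in> F" "L \<subseteq> ?W"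
  proof -
    have FW: "F = ?W" using flat_with_zero[OF F] that by simp
    have "?S = {Z \<in> subspaces n (Suc r). ?W \<subseteq> Z}" using FW that by auto
    \<comment> \<open>The \<open>n - r\<close> terms are split as \<open>1\<close> plus
      \<open>n - r - 1\<close> terms, so that \<open>q\<close> factors out of the rest and leaves
      the sum inverted by \<open>u'\<close> later.\<close>
    then have "card ?S = (\<Sum>i<Suc (n - r - 1). CARD('q) ^ i)"
      using card_superspaces[OF W] r by (simp add: Suc_diff_Suc)
    also have "\<dots> = 1 + CARD('q) * (\<Sum>i<n - r - 1. CARD('q) ^ i)"
      unfolding sum.lessThan_Suc_shift by (simp add: sum_distrib_left)
    finally show ?thesis using FW that card_line[OF L] by (simp add: Int_absorb1)
  qed
  show "card (F \<inter> L) = 1 \<and> card ?S = 1" if z: "0\<^sub>v n \<in> F" and LW: "\<not> L \<subseteq> ?W"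
  proof -
    have FW: "F = ?W" using flat_with_zero[OF F z] by simp
    have "F \<inter> L = {0\<^sub>v n}"
      using line_subset_iff[OF L _ _ Wl] z LW FW linear_set_zero[OF Ll] by blast
    obtain x where x: "x \<in> L" "x \<notin> ?W" using LW by blast
    then have xc: "x \<in> carrier_vec n" and x0: "x \<noteq> 0\<^sub>v n"
      using linear_set_carrier[OF Ll x(1)] linear_set_zero[OF Wl] by auto
    have "?S = {adjoin ?W x}"
    proof (intro equalityI subsetI)
      fix Z assume "Z \<in> ?S"
      then show "Z \<in> {adjoin ?W x}" using subspaces_Suc_eq_adjoin[OF W, of Z x] x FW by auto
    next
      fix Z assume "Z \<in> {adjoin ?W x}"
      then show "Z \<in> ?S"
        using adjoin_subspaces[OF W xc x(2)] adjoin_superset[OF Wl xc] FW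
          line_subset_iff[OF L x(1) x0 linear_set_adjoin[OF Wl xc]] by auto
    qed
    with \<open>F \<inter> L = {0\<^sub>v n}\<close> show ?thesis by simp
  qed
  \<comment> \<open>\<open>adjoin ?W v\<close> is the span of a flat off the origin, hence the only
    candidate for a member of \<open>?S\<close>.\<close>
  have nz: "\<exists>v. v \<in> F \<and> v \<in> carrier_vec n \<and> v \<notin> ?W \<and> ?S = (if L \<subseteq> adjoin ?W v then {adjoin ?W v} else {})"
    if z: "0\<^sub>v n \<notin> F"
  proof -
    obtain v where v: "v \<in> F" using flat_nonempty[OF F] by blast
    then have vc: "v \<in> carrier_vec n" using flat_subset[OF F] by blast
    have vW: "v \<notin> ?W" using flat_zero_iff[OF F v] z by simp
    have eq: "Z = adjoin ?W v" if Z: "Z \<in> ?S" for Z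
      using Z flat_subset_linear_iff[OF F v, of Z] subspaces_linear_set[of Z n "Suc r"]
        subspaces_Suc_eq_adjoin[OF W, of Z v] vW by auto
    have sub: "F \<subseteq> adjoin ?W v" "adjoin ?W v \<in> subspaces n (Suc r)"
      using flat_subset_linear_iff[OF F v linear_set_adjoin[OF Wl vc]] adjoin_superset[OF Wl vc]
        adjoin_subspaces[OF W vc vW] by simp_all
    have "?S = (if L \<subseteq> adjoin ?W v then {adjoin ?W v} else {})"
    proof (cases "L \<subseteq> adjoin ?W v")
      case True
      with sub have "adjoin ?W v \<in> ?S" by simp
      with eq have "?S = {adjoin ?W v}" by blast
      with True show ?thesis by simp
    next
      case False
      with eq have "?S = {}" by blast
      with False show ?thesis by simp
    qed
    with v vc vW show ?thesis by blast
  qed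
  show "card (F \<inter> L) = 0 \<and> card ?S = 1" if z: "0\<^sub>v n \<notin> F" and LW: "L \<subseteq> ?W"
  proof -
    obtain v where v: "v \<in> F" "v \<in> carrier_vec n" "v \<notin> ?W"
      "?S = (if L \<subseteq> adjoin ?W v then {adjoin ?W v} else {})" using nz[OF z] by blast
    have "L \<subseteq> adjoin ?W v" using LW adjoin_superset[OF Wl v(2)] by blast
    moreover have "F \<inter> L = {}" using flat_zero_iff[OF F] z LW by blast
    ultimately show ?thesis using v(4) by simp
  qed
  show "card (F \<inter> L) = card ?S" if z: "0\<^sub>v n \<notin> F" and LW: "\<not> L \<subseteq> ?W"
  proof -
    obtain v where v: "v \<in> F" "v \<in> carrier_vec n" "v \<notin> ?W"
      "?S = (if L \<subseteq> adjoin ?W v then {adjoin ?W v} else {})" using nz[OF z] by blast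
    \<comment> \<open>The difference of two common points would be a nonzero vector of
      \<open>L\<close> in \<open>?W\<close>, forcing all of \<open>L\<close> into
      \<open>?W\<close>.\<close>
    have uniq: "y = y'" if "y \<in> F \<inter> L" "y' \<in> F \<inter> L" for y y'
    proof (rule ccontr)
      assume "y \<noteq> y'"
      have c: "y \<in> carrier_vec n" "y' \<in> carrier_vec n" using that flat_subset[OF F] by auto
      have "y = (y - y') + y'" using c by (intro eq_vecI) auto
      then have "y - y' \<noteq> 0\<^sub>v n" using \<open>y \<noteq> y'\<close> c by auto
      moreover have "y - y' \<in> L" "y - y' \<in> ?W"
        using that linear_set_diff[OF Ll] unfolding direction_def by auto
      ultimately show False using line_subset_iff[OF L _ _ Wl] LW by blast
    qed
    show ?thesis
    proof (cases "L \<subseteq> adjoin ?W v")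
      case True
      obtain x where x: "x \<in> L" "x \<notin> ?W" using LW by blast
      then have xc: "x \<in> carrier_vec n" using linear_set_carrier[OF Ll] by blast
      obtain w c where wc: "w \<in> ?W" "x = w + c \<cdot>\<^sub>v v" using True x unfolding adjoin_def by blast
      have wcarr: "w \<in> carrier_vec n" using linear_set_carrier[OF Wl wc(1)] .
      have "w + 0 \<cdot>\<^sub>v v = w" using v(2) wcarr by (intro eq_vecI) auto
      then have "c \<noteq> 0" using wc x by auto
      \<comment> \<open>Rescaling \<open>x\<close> so that its coefficient at \<open>v\<close>
        becomes \<open>1\<close> moves it into the translate of \<open>?W\<close> by
        \<open>v\<close>, which is \<open>F\<close>.\<close>
      let ?y = "inverse c \<cdot>\<^sub>v x"
      have "?y - v = inverse c \<cdot>\<^sub>v w"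
        unfolding wc(2) using v(2) wcarr \<open>c \<noteq> 0\<close> by (intro eq_vecI) (auto simp: field_simps)
      then have "?y \<in> F"
        using flat_mem_iff[OF F v(1), of ?y] xc linear_set_smult[OF Wl wc(1)] by simp
      moreover have "?y \<in> L" using linear_set_smult[OF Ll x(1)] .
      ultimately have "F \<inter> L = {?y}" using uniq by blast
      then show ?thesis using v(4) True by simp
    next
      case False
      have "F \<inter> L = {}"
      proof (rule ccontr)
        assume "F \<inter> L \<noteq> {}"
        then obtain y where y: "y \<in> F" "y \<in> L" by blast
        then have "y \<noteq> 0\<^sub>v n" using z by auto
        moreover have "y \<in> adjoin ?W v"
          using y flat_subset_linear_iff[OF F v(1) linear_set_adjoin[OF Wl v(2)]] adjoin_superset[OF Wl v(2)] by blast
        ultimately show False using line_subset_iff[OF L y(2) _ linear_set_adjoin[OF Wl v(2)]] False by blast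
      qed
      then show ?thesis unfolding v(4) using False by simp
    qed
  qed
qed

text \<open>For \<open>F\<close> through the origin, a constant \<open>x\<close> and a weight
  \<open>y\<close> must satisfy \<open>x - 1 + y = 0\<close> and
  \<open>x - q + y (1 + q s) = 1\<close>, with \<open>s\<close> the geometric sum. These equations
  are solved by \<open>y = u'\<close> and \<open>x = 1 - u'\<close> when
  \<open>s u' = 1\<close>.\<close>

lemma flat_line_identity:
  fixes F :: "'q :: {field, finite} vec set" and u' :: "'r :: comm_ring_1"
  assumes F: "F \<in> flats n r" and L: "L \<in> subspaces n 1" and r: "r + 2 \<le> n"
    and u': "of_nat (\<Sum>i<n - r - 1. CARD('q) ^ i) * u' = 1"
  shows "(if 0\<^sub>v n \<in> F then 1 - u' else 0) - of_nat (card (F \<inter> L)) +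
      (if 0\<^sub>v n \<in> F then u' else 1) * of_nat (card {Z \<in> subspaces n (Suc r). F \<subseteq> Z \<and> L \<subseteq> Z})
    = (if L \<subseteq> direction F then 1 else 0)"
proof -
  have "u' * (1 + of_nat CARD('q) * of_nat (\<Sum>i<n - r - 1. CARD('q) ^ i)) = u' + of_nat CARD('q) * (of_nat (\<Sum>i<n - r - 1. CARD('q) ^ i) * u')"
    by (simp only: algebra_simps mult_1_right mult_1_left)
  then have "u' * (1 + of_nat CARD('q) * of_nat (\<Sum>i<n - r - 1. CARD('q) ^ i)) = u' + of_nat CARD('q)"
    unfolding u' by simp
  then show ?thesis
    using card_flat_line_superspaces[OF F L r]
    by (cases "0\<^sub>v n \<in> F"; cases "L \<subseteq> direction F") (auto simp del: of_nat_sum)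
qed

section \<open>Combinations of indicator functions of \<open>r\<close>-flats: the row module of the
  affine incidence matrix\<close>

definition flat_span :: "nat \<Rightarrow> nat \<Rightarrow> ('q :: field vec \<Rightarrow> 'r :: comm_ring_1) set" where
  "flat_span n r = {f. \<exists>c. \<forall>z\<in>carrier_vec n. f z = (\<Sum>G\<in>flats n r. c G * of_bool (z \<in> G))}"

lemma flat_span_cong:
  "f \<in> flat_span n r \<Longrightarrow> (\<And>z. z \<in> carrier_vec n \<Longrightarrow> f z = g z) \<Longrightarrow> g \<in> flat_span n r"
  unfolding flat_span_def by auto

lemma flat_span_add:
  assumes "f \<in> flat_span n r" "g \<in> flat_span n r"
  shows "(\<lambda>z. f z + g z) \<in> flat_span n r"
proof -
  obtain a b where "\<And>z. z \<in> carrier_vec n \<Longrightarrow> f z = (\<Sum>G\<in>flats n r. a G * of_bool (z \<in> G))"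
    "\<And>z. z \<in> carrier_vec n \<Longrightarrow> g z = (\<Sum>G\<in>flats n r. b G * of_bool (z \<in> G))"
    using assms unfolding flat_span_def by blast
  then show ?thesis
    unfolding flat_span_def
    by (intro CollectI exI[of _ "\<lambda>G. a G + b G"]) (simp add: distrib_right sum.distrib)
qed

lemma flat_span_scale:
  assumes "f \<in> flat_span n r"
  shows "(\<lambda>z. k * f z) \<in> flat_span n r"
proof -
  obtain a where "\<And>z. z \<in> carrier_vec n \<Longrightarrow> f z = (\<Sum>G\<in>flats n r. a G * of_bool (z \<in> G))"
    using assms unfolding flat_span_def by blast
  then show ?thesis
    unfolding flat_span_def
    by (intro CollectI exI[of _ "\<lambda>G. k * a G"]) (simp add: sum_distrib_left mult.assoc)
qed

lemma flat_span_diff: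
  assumes "f \<in> flat_span n r" "g \<in> flat_span n r"
  shows "(\<lambda>z. f z - g z) \<in> flat_span n r"
  using flat_span_add[OF assms(1) flat_span_scale[OF assms(2), of "- 1"]] by simp

lemma flat_span_sum:
  assumes "finite I" "\<And>i. i \<in> I \<Longrightarrow> f i \<in> flat_span n r"
  shows "(\<lambda>z. \<Sum>i\<in>I. f i z) \<in> flat_span n r"
  using assms
proof (induction I rule: finite_induct)
  case empty
  show ?case unfolding flat_span_def by (intro CollectI exI[of _ "\<lambda>_. 0"]) simp
next
  case (insert i I)
  have "(\<lambda>z. f i z + (\<Sum>i\<in>I. f i z)) \<in> flat_span n r"
    by (rule flat_span_add) (use insert in auto)
  then show ?case using insert by simp
qed

lemma flat_span_flat:
  fixes F :: "'q :: {field, finite} vec set"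
  assumes "F \<in> flats n r"
  shows "(\<lambda>z. of_bool (z \<in> F)) \<in> (flat_span n r :: ('q vec \<Rightarrow> 'r :: comm_ring_1) set)"
proof -
  have "(\<Sum>G\<in>flats n r. of_bool (G = F) * of_bool (z \<in> G)) = (of_bool (z \<in> F) :: 'r)" for z
  proof -
    have "(\<Sum>G\<in>flats n r. of_bool (G = F) * of_bool (z \<in> G)) = (\<Sum>G\<in>flats n r. if G = F then of_bool (z \<in> F) else (0 :: 'r))"
      by (rule sum.cong) auto
    then show ?thesis using assms finite_flats[of n r, where ?'q = 'q] by simp
  qed
  then show ?thesis
    unfolding flat_span_def by (intro CollectI exI[of _ "\<lambda>G. of_bool (G = F)"]) simp
qed

text \<open>
  The \<open>q + 1\<close> flats between \<open>F\<close> and \<open>G = a + \<langle>W, v, w\<rangle>\<close> cover \<open>F\<close> with multiplicity \<open>q + 1\<close> and the rest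
  of \<open>G\<close> once, whereas the translates of \<open>a + \<langle>W, v\<rangle>\<close> in \<open>G\<close> partition \<open>G\<close>.
\<close>

lemma pencil_identity:
  fixes F :: "'q :: {field, finite} vec set"
  assumes F: "F \<in> flats n j" and a: "a \<in> F"
    and v: "v \<in> carrier_vec n" "v \<notin> direction F"
    and w: "w \<in> carrier_vec n" "w \<notin> adjoin (direction F) v"
    and z: "z \<in> carrier_vec n"
  shows "of_nat CARD('q) * of_bool (z \<in> F) =
     of_bool (z \<in> (\<lambda>x. a + x) ` adjoin (direction F) w)
     + (\<Sum>c\<in>UNIV. of_bool (z \<in> (\<lambda>x. a + x) ` adjoin (direction F) (v + c \<cdot>\<^sub>v w)))
     - (\<Sum>c\<in>UNIV. of_bool (z \<in> (\<lambda>x. (a + c \<cdot>\<^sub>v w) + x) ` adjoin (direction F) v) :: 'r :: comm_ring_1)"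
proof -
  let ?W = "direction F"
  define y where "y = z - a"
  \<comment> \<open>\<open>M \<gamma> \<delta>\<close> says that, modulo \<open>?W\<close>, the
    vector \<open>z - a\<close> has coordinates \<gamma> and \<delta> with respect to
    \<open>v\<close> and \<open>w\<close>.\<close>
  define M where "M \<gamma> \<delta> \<longleftrightarrow> y - \<delta> \<cdot>\<^sub>v w - \<gamma> \<cdot>\<^sub>v v \<in> ?W" for \<gamma> \<delta>
  have W: "linear_set n ?W" using subspaces_linear_set[OF flat_direction[OF F]] .
  have Wv: "linear_set n (adjoin ?W v)" using linear_set_adjoin[OF W v(1)] .
  have ac: "a \<in> carrier_vec n" using a flat_subset[OF F] by blast
  have y: "y \<in> carrier_vec n" using z ac by (simp add: y_def)
  have uniq: "\<gamma> = \<gamma>' \<and> \<delta> = \<delta>'" if M: "M \<gamma> \<delta>" "M \<gamma>' \<delta>'" for \<gamma> \<delta> \<gamma>' \<delta>'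
  proof -
    have "y - \<delta> \<cdot>\<^sub>v w \<in> adjoin ?W v" "y - \<delta>' \<cdot>\<^sub>v w \<in> adjoin ?W v"
      using M unfolding M_def by (subst adjoin_iff[OF W v(1)]; use y w in auto)+
    then have "\<delta> = \<delta>'" by (rule adjoin_coeff_unique[OF Wv w y])
    moreover have "\<gamma> = \<gamma>'"
      by (rule adjoin_coeff_unique[OF W v, of "y - \<delta> \<cdot>\<^sub>v w"]) (use M y w \<open>\<delta> = \<delta>'\<close> in \<open>auto simp: M_def\<close>)
    ultimately show ?thesis by simp
  qed
  have "y - 0 \<cdot>\<^sub>v w - 0 \<cdot>\<^sub>v v = y" using y v(1) w(1) by (intro eq_vecI) auto
  then have 1: "z \<in> F \<longleftrightarrow> M 0 0"
    unfolding M_def using flat_mem_iff[OF F a z] by (simp add: y_def)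
  have "y - \<delta> \<cdot>\<^sub>v w - 0 \<cdot>\<^sub>v v = y - \<delta> \<cdot>\<^sub>v w" for \<delta> using y v(1) w(1) by (intro eq_vecI) auto
  then have 2: "z \<in> (\<lambda>x. a + x) ` adjoin ?W w \<longleftrightarrow> (\<exists>\<delta>. M 0 \<delta>)"
    unfolding M_def mem_translate_iff[OF linear_set_adjoin[OF W w(1)] ac z]
    using adjoin_iff[OF W w(1) y] by (simp add: y_def)
  \<comment> \<open>In the plane of these coordinates, the flats containing \<open>F\<close> are the
    lines through the origin: the axis \<gamma> = 0 and the lines of slope \<open>c\<close>. The
    translates in the next step are the parallels to the \<gamma>-axis.\<close>
  have 3: "z \<in> (\<lambda>x. a + x) ` adjoin ?W (v + c \<cdot>\<^sub>v w) \<longleftrightarrow> (\<exists>\<gamma>. M \<gamma> (\<gamma> * c))" for c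
  proof -
    have vw: "v + c \<cdot>\<^sub>v w \<in> carrier_vec n" using v(1) w(1) by simp
    have "y - \<gamma> \<cdot>\<^sub>v (v + c \<cdot>\<^sub>v w) = y - (\<gamma> * c) \<cdot>\<^sub>v w - \<gamma> \<cdot>\<^sub>v v" for \<gamma>
      using y v(1) w(1) by (intro eq_vecI) (auto simp: algebra_simps)
    then show ?thesis
      unfolding M_def mem_translate_iff[OF linear_set_adjoin[OF W vw] ac z]
      using adjoin_iff[OF W vw y] by (simp add: y_def)
  qed
  have 4: "z \<in> (\<lambda>x. (a + c \<cdot>\<^sub>v w) + x) ` adjoin ?W v \<longleftrightarrow> (\<exists>\<gamma>. M \<gamma> c)" for c
  proof -
    have aw: "a + c \<cdot>\<^sub>v w \<in> carrier_vec n" using ac w(1) by simp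
    have "z - (a + c \<cdot>\<^sub>v w) = y - c \<cdot>\<^sub>v w"
      unfolding y_def using z ac w(1) by (intro eq_vecI) (auto simp: algebra_simps)
    then show ?thesis
      unfolding M_def mem_translate_iff[OF Wv aw z]
      using adjoin_iff[OF W v(1), of "y - c \<cdot>\<^sub>v w"] y w(1) by simp
  qed
  have delta: "(\<Sum>c\<in>UNIV. of_bool (c = b)) = (1 :: 'r)" for b :: 'q
    by (simp add: of_bool_def)
  show ?thesis
    unfolding 1 2 3 4
  proof (cases "\<exists>\<alpha> \<beta>. M \<alpha> \<beta>")
    case False
    then show "of_nat CARD('q) * of_bool (M 0 0) =
      of_bool (\<exists>\<delta>. M 0 \<delta>) + (\<Sum>c\<in>UNIV. of_bool (\<exists>\<gamma>. M \<gamma> (\<gamma> * c))) - (\<Sum>c\<in>UNIV. of_bool (\<exists>\<gamma>. M \<gamma> c) :: 'r)"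
      by simp
  next
    case True
    then obtain \<alpha> \<beta> where "M \<alpha> \<beta>" by blast
    then have M: "M \<gamma> \<delta> \<longleftrightarrow> \<gamma> = \<alpha> \<and> \<delta> = \<beta>" for \<gamma> \<delta> using uniq by blast
    have "(\<Sum>c\<in>UNIV. of_bool (\<exists>\<gamma>. M \<gamma> c)) = (1 :: 'r)" using delta[of \<beta>] by (simp add: M)
    moreover have "(\<Sum>c\<in>UNIV. of_bool (\<exists>\<gamma>. M \<gamma> (\<gamma> * c))) = (\<Sum>c\<in>UNIV. of_bool (\<alpha> * c = \<beta>) :: 'r)"
      by (simp add: M)
    \<comment> \<open>Among the lines of finite slope, a point off the axis \<gamma> = 0 lies on
      exactly one; a point of that axis lies on all of them or none, according to whether it is the
      origin.\<close>
    moreover have "\<dots> = (if \<alpha> = 0 then of_nat CARD('q) * of_bool (\<beta> = 0) else 1)"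
    proof (cases "\<alpha> = 0")
      case False
      then have "\<alpha> * c = \<beta> \<longleftrightarrow> c = \<beta> / \<alpha>" for c by (auto simp: field_simps)
      with delta[of "\<beta> / \<alpha>"] False show ?thesis by simp
    qed auto
    ultimately show "of_nat CARD('q) * of_bool (M 0 0) =
      of_bool (\<exists>\<delta>. M 0 \<delta>) + (\<Sum>c\<in>UNIV. of_bool (\<exists>\<gamma>. M \<gamma> (\<gamma> * c))) - (\<Sum>c\<in>UNIV. of_bool (\<exists>\<gamma>. M \<gamma> c) :: 'r)"
      by (auto simp: M)
  qed
qed

text \<open>Each application of \<open>pencil_identity\<close> raises the dimension by one at the
  cost of a factor \<open>q\<close>. The case \<open>e = r\<close> reaches the points.\<close>

lemma flat_span_lower_flat:
  fixes F :: "'q :: {field, finite} vec set"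
  assumes "r < n" "e \<le> r" "F \<in> flats n (r - e)"
  shows "(\<lambda>z. of_nat CARD('q) ^ e * of_bool (z \<in> F)) \<in> (flat_span n r :: ('q vec \<Rightarrow> 'r :: comm_ring_1) set)"
  using assms
proof (induction e arbitrary: F)
  case 0
  then show ?case using flat_span_flat[of F n r] by simp
next
  case (Suc e)
  let ?W = "direction F" and ?j = "r - Suc e"
  have F: "F \<in> flats n ?j" and j: "Suc ?j = r - e" using Suc.prems by auto
  have W: "?W \<in> subspaces n ?j" using flat_direction[OF F] .
  obtain a where a: "a \<in> F" using flat_nonempty[OF F] by blast
  then have ac: "a \<in> carrier_vec n" using flat_subset[OF F] by blast
  obtain v where v: "v \<in> carrier_vec n" "v \<notin> ?W"
    by (rule exists_not_in_subspace[OF W]) (use Suc.prems in auto)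
  have Wv: "adjoin ?W v \<in> subspaces n (Suc ?j)" using adjoin_subspaces[OF W v] .
  \<comment> \<open>A second new direction exists because \<open>Suc ?j \<le> r < n\<close>.\<close>
  obtain w where w: "w \<in> carrier_vec n" "w \<notin> adjoin ?W v"
    by (rule exists_not_in_subspace[OF Wv]) (use Suc.prems in auto)
  have Wl: "linear_set n ?W" using subspaces_linear_set[OF W] .
  have "w \<notin> ?W" using w(2) adjoin_superset[OF Wl v(1)] by blast
  have vw: "v + c \<cdot>\<^sub>v w \<in> carrier_vec n \<and> v + c \<cdot>\<^sub>v w \<notin> ?W" for c
  proof (intro conjI notI)
    assume *: "v + c \<cdot>\<^sub>v w \<in> ?W"
    then have "v + c \<cdot>\<^sub>v w \<in> adjoin ?W v" using adjoin_superset[OF Wl v(1)] by blast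
    then have cw: "c \<cdot>\<^sub>v w \<in> adjoin ?W v"
      using linear_set_add_cancel[OF subspaces_linear_set[OF Wv] adjoin_superset(2)[OF Wl v(1)]] w(1) by auto
    show False
    proof (cases "c = 0")
      case True
      then have "v + c \<cdot>\<^sub>v w = v" using v(1) w(1) by (intro eq_vecI) auto
      with * v(2) show False by simp
    next
      case False
      then show False using linear_set_smult_cancel[OF subspaces_linear_set[OF Wv] cw] w(2) by simp
    qed
  qed (use v w in simp)
  have IH: "(\<lambda>z. of_nat CARD('q) ^ e * of_bool (z \<in> (\<lambda>x. b + x) ` U)) \<in> (flat_span n r :: ('q vec \<Rightarrow> 'r) set)"
    if "U \<in> subspaces n (Suc ?j)" "b \<in> carrier_vec n" for U b
    using Suc.IH[of "(\<lambda>x. b + x) ` U"] translate_in_flats[OF that] Suc.prems j by simp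
  have "(\<lambda>z. of_nat CARD('q) ^ e * of_bool (z \<in> (\<lambda>x. a + x) ` adjoin ?W w)
     + (\<Sum>c\<in>UNIV. of_nat CARD('q) ^ e * of_bool (z \<in> (\<lambda>x. a + x) ` adjoin ?W (v + c \<cdot>\<^sub>v w)))
     - (\<Sum>c\<in>UNIV. of_nat CARD('q) ^ e * of_bool (z \<in> (\<lambda>x. (a + c \<cdot>\<^sub>v w) + x) ` adjoin ?W v))) \<in> (flat_span n r :: ('q vec \<Rightarrow> 'r) set)"
    by (intro flat_span_add flat_span_diff flat_span_sum IH)
      (use adjoin_subspaces[OF W] Wv w \<open>w \<notin> ?W\<close> vw ac in auto)
  then show ?case
  proof (rule flat_span_cong)
    fix z :: "'q vec" assume z: "z \<in> carrier_vec n"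
    show "of_nat CARD('q) ^ e * of_bool (z \<in> (\<lambda>x. a + x) ` adjoin ?W w)
     + (\<Sum>c\<in>UNIV. of_nat CARD('q) ^ e * of_bool (z \<in> (\<lambda>x. a + x) ` adjoin ?W (v + c \<cdot>\<^sub>v w)))
     - (\<Sum>c\<in>UNIV. of_nat CARD('q) ^ e * of_bool (z \<in> (\<lambda>x. (a + c \<cdot>\<^sub>v w) + x) ` adjoin ?W v))
      = (of_nat CARD('q) ^ Suc e * of_bool (z \<in> F) :: 'r)"
      unfolding sum_distrib_left[symmetric] distrib_left[symmetric] right_diff_distrib[symmetric]
        pencil_identity[OF F a v w z, symmetric] by (simp only: power_Suc2 mult.assoc)
  qed
qed

lemma point_in_flats:
  assumes "z \<in> carrier_vec n"
  shows "{z :: 'q :: {field, finite} vec} \<in> flats n 0"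
  using translate_in_flats[of "{0\<^sub>v n}" n 0 z] assms by (simp add: subspaces_0)

section \<open>The projective closure\<close>

lemma vCons_add: "v \<in> carrier_vec n \<Longrightarrow> w \<in> carrier_vec n \<Longrightarrow> vCons a v + vCons b w = vCons (a + b) (v + w)"
  by (rule eq_vecI) (auto simp: vec_index_vCons)

lemma vCons_smult: "c \<cdot>\<^sub>v vCons a v = vCons (c * a) (c \<cdot>\<^sub>v v)"
  by (rule eq_vecI) (auto simp: vec_index_vCons)

lemma vCons_diff: "v \<in> carrier_vec n \<Longrightarrow> w \<in> carrier_vec n \<Longrightarrow> vCons a v - vCons b w = vCons (a - b) (v - w)"
  by (rule eq_vecI) (auto simp: vec_index_vCons)

lemma vCons_mem_infinity_iff: "vCons a w \<in> vCons 0 ` W \<longleftrightarrow> a = 0 \<and> w \<in> W"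
  by (auto simp: image_iff)

lemma infinity_subset_iff: "vCons 0 ` V \<subseteq> vCons 0 ` W \<longleftrightarrow> V \<subseteq> W"
  by (auto simp: image_iff subset_eq)

lemma linear_set_infinity:
  fixes W :: "'q :: field vec set"
  assumes W: "linear_set n W"
  shows "linear_set (Suc n) (vCons 0 ` W)"
  unfolding linear_set_def
proof (intro conjI ballI allI)
  show "vCons 0 ` W \<subseteq> carrier_vec (Suc n)" using linear_set_carrier[OF W] by auto
  show "0\<^sub>v (Suc n) \<in> vCons 0 ` W" using linear_set_zero[OF W] by (simp add: zero_vec_Suc)
next
  fix x y assume "x \<in> vCons 0 ` W" "y \<in> vCons 0 ` W"
  then obtain v w where *: "v \<in> W" "x = vCons 0 v" "w \<in> W" "y = vCons 0 w" by blast
  then have "x + y = vCons 0 (v + w)"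
    using vCons_add[OF linear_set_carrier[OF W *(1)] linear_set_carrier[OF W *(3)], of 0 0] by simp
  with linear_set_add[OF W *(1,3)] show "x + y \<in> vCons 0 ` W" by blast
next
  fix c x assume "x \<in> vCons 0 ` W"
  then obtain v where *: "v \<in> W" "x = vCons 0 v" by blast
  then have "c \<cdot>\<^sub>v x = vCons 0 (c \<cdot>\<^sub>v v)" by (simp add: vCons_smult)
  with linear_set_smult[OF W *(1)] show "c \<cdot>\<^sub>v x \<in> vCons 0 ` W" by blast
qed

lemma infinity_subspaces:
  fixes W :: "'q :: {field, finite} vec set"
  assumes "W \<in> subspaces n k"
  shows "vCons 0 ` W \<in> subspaces (Suc n) k"
  using assms linear_set_infinity[of n W] card_image[of "vCons 0" W]
  by (simp add: subspaces_iff inj_on_def)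

text \<open>Homogenisation: affine points have first coordinate \<open>1\<close>, points at infinity
  first coordinate \<open>0\<close>. The choice of base point is harmless, as
  \<open>vCons_1_mem_cone_iff\<close> shows.\<close>

definition cone :: "'q :: field vec set \<Rightarrow> 'q vec set" where
  "cone F = adjoin (vCons 0 ` direction F) (vCons 1 (SOME v. v \<in> F))"

context
  fixes F :: "'q :: {field, finite} vec set" and n k :: nat
  assumes F: "F \<in> flats n k"
begin

lemma some_in_flat: "(SOME v. v \<in> F) \<in> F"
  using flat_nonempty[OF F] by (simp add: some_in_eq)

lemma cone_subspaces: "cone F \<in> subspaces (Suc n) (Suc k)"
  unfolding cone_def
  by (rule adjoin_subspaces[OF infinity_subspaces[OF flat_direction[OF F]]])
    (use some_in_flat flat_subset[OF F] in \<open>auto simp: vCons_mem_infinity_iff\<close>)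

text \<open>The coefficient of the base vector must equal the first coordinate \<open>c\<close>;
  what remains after subtraction lies at infinity.\<close>

lemma vCons_mem_cone_iff:
  assumes w: "w \<in> carrier_vec n"
  shows "vCons c w \<in> cone F \<longleftrightarrow> w - c \<cdot>\<^sub>v (SOME v. v \<in> F) \<in> direction F"
proof -
  let ?v = "SOME v. v \<in> F"
  have v: "?v \<in> carrier_vec n" using some_in_flat flat_subset[OF F] by blast
  have "vCons c w - b \<cdot>\<^sub>v vCons 1 ?v = vCons (c - b) (w - b \<cdot>\<^sub>v ?v)" for b
    using vCons_diff[OF w, of "b \<cdot>\<^sub>v ?v" c b] v by (simp add: vCons_smult)
  then show ?thesis
    unfolding cone_def using w v
      adjoin_iff[OF linear_set_infinity[OF subspaces_linear_set[OF flat_direction[OF F]]], of "vCons 1 ?v" "vCons c w"]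
    by (auto simp: vCons_mem_infinity_iff)
qed

lemma vCons_0_mem_cone_iff: "w \<in> carrier_vec n \<Longrightarrow> vCons 0 w \<in> cone F \<longleftrightarrow> w \<in> direction F"
proof -
  assume w: "w \<in> carrier_vec n"
  have "(SOME v. v \<in> F) \<in> carrier_vec n" using some_in_flat flat_subset[OF F] by blast
  with w have "w - 0 \<cdot>\<^sub>v (SOME v. v \<in> F) = w" by (intro eq_vecI) auto
  with vCons_mem_cone_iff[OF w, of 0] show ?thesis by simp
qed

lemma vCons_1_mem_cone_iff: "w \<in> carrier_vec n \<Longrightarrow> vCons 1 w \<in> cone F \<longleftrightarrow> w \<in> F"
  using vCons_mem_cone_iff[of w 1] flat_mem_iff[OF F some_in_flat, of w] by simp

lemma infinity_subset_cone_iff: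
  assumes "L \<subseteq> carrier_vec n"
  shows "vCons 0 ` L \<subseteq> cone F \<longleftrightarrow> L \<subseteq> direction F"
  using assms vCons_0_mem_cone_iff by (auto simp: subset_eq)

lemma cone_neq_infinity: "cone F \<noteq> vCons 0 ` W"
proof
  assume eq: "cone F = vCons 0 ` W"
  have "(SOME v. v \<in> F) \<in> carrier_vec n" using some_in_flat flat_subset[OF F] by blast
  then have "vCons 1 (SOME v. v \<in> F) \<in> cone F" using vCons_1_mem_cone_iff some_in_flat by simp
  then show False unfolding eq by (simp add: vCons_mem_infinity_iff)
qed

end

lemma inj_on_cone: "inj_on cone (flats n k :: 'q :: {field, finite} vec set set)"
proof (rule inj_onI)
  fix F G :: "'q vec set" assume *: "F \<in> flats n k" "G \<in> flats n k" "cone F = cone G"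
  have "H = {w \<in> carrier_vec n. vCons 1 w \<in> cone H}" if "H \<in> flats n k" for H :: "'q vec set"
    using vCons_1_mem_cone_iff[OF that] flat_subset[OF that] by blast
  with * show "F = G" by metis
qed

lemma point_cone_subset_iff:
  fixes z :: "'q :: {field, finite} vec"
  assumes z: "z \<in> carrier_vec n" and V: "linear_set (Suc n) V"
  shows "cone {z} \<subseteq> V \<longleftrightarrow> vCons 1 z \<in> V"
proof (rule line_subset_iff[OF _ _ _ V])
  show "cone {z} \<in> subspaces (Suc n) 1" using cone_subspaces[OF point_in_flats[OF z]] by simp
  show "vCons 1 z \<in> cone {z}" using vCons_1_mem_cone_iff[OF point_in_flats[OF z] z] by simp
  show "vCons 1 z \<noteq> 0\<^sub>v (Suc n)" by (simp add: zero_vec_Suc)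
qed

text \<open>A subspace either lies at infinity or contains a vector with first coordinate
  \<open>1\<close>. In the second case its part \<open>W\<close> at infinity has one dimension less,
  and it is the cone over a translate of \<open>W\<close>.\<close>

lemma subspaces_Suc_eq:
  "(subspaces (Suc n) (Suc k) :: 'q :: {field, finite} vec set set)
    = cone ` flats n k \<union> (`) (vCons 0) ` subspaces n (Suc k)"
proof (intro equalityI subsetI)
  fix V :: "'q vec set" assume "V \<in> cone ` flats n k \<union> (`) (vCons 0) ` subspaces n (Suc k)"
  then show "V \<in> subspaces (Suc n) (Suc k)" using cone_subspaces infinity_subspaces by blast
next
  fix V :: "'q vec set" assume V: "V \<in> subspaces (Suc n) (Suc k)"
  then have Vl: "linear_set (Suc n) V" and cardV: "card V = CARD('q) ^ Suc k" by (auto simp: subspaces_iff)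
  define W where "W = {w \<in> carrier_vec n. vCons 0 w \<in> V}"
  have W: "linear_set n W"
    unfolding linear_set_def
  proof (intro conjI ballI allI)
    show "0\<^sub>v n \<in> W" using linear_set_zero[OF Vl] by (simp add: W_def zero_vec_Suc)
  next
    fix u w assume "u \<in> W" "w \<in> W"
    then show "u + w \<in> W" using linear_set_add[OF Vl, of "vCons 0 u" "vCons 0 w"] vCons_add[of u n w 0 0] by (simp add: W_def)
  next
    fix c w assume "w \<in> W"
    then show "c \<cdot>\<^sub>v w \<in> W" using linear_set_smult[OF Vl, of "vCons 0 w" c] by (simp add: W_def vCons_smult)
  qed (auto simp: W_def)
  have WV: "vCons 0 ` W \<subseteq> V" by (auto simp: W_def)
  have card_inf: "card (vCons 0 ` W) = card W" by (rule card_image) (simp add: inj_on_def)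
  show "V \<in> cone ` flats n k \<union> (`) (vCons 0) ` subspaces n (Suc k)"
  proof (cases "V \<subseteq> vCons 0 ` W")
    case True
    with WV have "V = vCons 0 ` W" by blast
    moreover from this have "W \<in> subspaces n (Suc k)" using W cardV card_inf by (simp add: subspaces_iff)
    ultimately show ?thesis by blast
  next
    case False
    then obtain x where x: "x \<in> V" "x \<notin> vCons 0 ` W" by blast
    then have xc: "x \<in> carrier_vec (Suc n)" using linear_set_carrier[OF Vl] by blast
    then obtain b y where by': "x = vCons b y" by (cases x) auto
    then have y: "y \<in> carrier_vec n" using xc by simp
    have b: "b \<noteq> 0" using x y unfolding by' by (auto simp: W_def)
    define v where "v = inverse b \<cdot>\<^sub>v y"
    have v: "v \<in> carrier_vec n" using y by (simp add: v_def)
    have vV: "vCons 1 v \<in> V" using linear_set_smult[OF Vl x(1), of "inverse b"] b by (simp add: by' vCons_smult v_def)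
    let ?F = "(\<lambda>w. v + w) ` W"
    \<comment> \<open>Subtracting \<open>c\<close> times \<open>vCons 1 v\<close> from a vector with
      first coordinate \<open>c\<close> sends it to infinity, that is, into
      \<open>W\<close>.\<close>
    have sub: "V \<subseteq> adjoin (vCons 0 ` W) (vCons 1 v)"
    proof
      fix s assume s: "s \<in> V"
      then have sc: "s \<in> carrier_vec (Suc n)" using linear_set_carrier[OF Vl] by blast
      then obtain c w where cw: "s = vCons c w" by (cases s) auto
      then have w: "w \<in> carrier_vec n" using sc by simp
      have "s - c \<cdot>\<^sub>v vCons 1 v = vCons 0 (w - c \<cdot>\<^sub>v v)"
        using vCons_diff[OF w, of "c \<cdot>\<^sub>v v" c c] v by (simp add: cw vCons_smult)
      moreover have "s - c \<cdot>\<^sub>v vCons 1 v \<in> V"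
        using linear_set_diff[OF Vl s linear_set_smult[OF Vl vV]] .
      ultimately have "s - c \<cdot>\<^sub>v vCons 1 v \<in> vCons 0 ` W" using w v by (simp add: vCons_mem_infinity_iff W_def)
      then show "s \<in> adjoin (vCons 0 ` W) (vCons 1 v)"
        using adjoin_iff[OF linear_set_infinity[OF W], of "vCons 1 v" s] v sc by auto
    qed
    have "adjoin (vCons 0 ` W) (vCons 1 v) \<subseteq> V" by (rule adjoin_least[OF Vl WV vV])
    with sub have Veq: "V = adjoin (vCons 0 ` W) (vCons 1 v)" by blast
    have "card V = CARD('q) * card W"
      unfolding Veq card_inf[symmetric]
      by (rule card_adjoin[OF linear_set_infinity[OF W]]) (use v in \<open>auto simp: vCons_mem_infinity_iff\<close>)
    then have Wk: "W \<in> subspaces n k" using W cardV by (simp add: subspaces_iff)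
    have F: "?F \<in> flats n k" using translate_in_flats[OF Wk v] .
    have dir: "direction ?F = W" using direction_translate[OF W v] .
    \<comment> \<open>The base point chosen in \<open>cone\<close> may differ from \<open>v\<close>
      by an element of \<open>W\<close>, so only this inclusion is proved and equal cardinalities
      finish.\<close>
    have "cone ?F \<subseteq> V"
      unfolding cone_def dir
    proof (rule adjoin_least[OF Vl WV])
      let ?s = "SOME u. u \<in> ?F"
      obtain w where w: "w \<in> W" "?s = v + w" using some_in_flat[OF F] by blast
      then have "vCons 1 ?s = vCons 1 v + vCons 0 w"
        using vCons_add[OF v linear_set_carrier[OF W w(1)], of 1 0] by simp
      then show "vCons 1 ?s \<in> V" using linear_set_add[OF Vl vV, of "vCons 0 w"] WV w(1) by auto
    qed
    moreover have "card (cone ?F) = card V" using cone_subspaces[OF F] cardV by (simp add: subspaces_iff)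
    ultimately have "cone ?F = V" using finite_linear_set[OF Vl] card_subset_eq by blast
    with F show ?thesis by blast
  qed
qed

lemma flats_0: "(flats n 0 :: 'q :: {field, finite} vec set set) = (\<lambda>z. {z}) ` carrier_vec n"
proof -
  have "z = z + 0\<^sub>v n" if "z \<in> carrier_vec n" for z :: "'q vec" using that by simp
  then show ?thesis unfolding flats_def subspaces_0 by fastforce
qed

section \<open>Incidence matrices\<close>

text \<open>Entries depend on labels rather than positions: block decomposition becomes
  concatenation of lists, and products become sums over sets.\<close>

definition table_mat :: "('y \<Rightarrow> 'z \<Rightarrow> 'r) \<Rightarrow> 'y list \<Rightarrow> 'z list \<Rightarrow> 'r mat" where
  "table_mat f Ys Zs = mat (length Ys) (length Zs) (\<lambda>(i, j). f (Ys ! i) (Zs ! j))"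

lemma table_mat_carrier [simp]: "table_mat f Ys Zs \<in> carrier_mat (length Ys) (length Zs)"
  by (simp add: table_mat_def)

lemma incidence_mat_eq_table_mat: "incidence_mat inc = table_mat (\<lambda>y z. of_bool (inc y z))"
  by (intro ext) (simp add: incidence_mat_def table_mat_def of_bool_def)

lemma table_mat_cong:
  assumes "\<And>y z. y \<in> set Ys \<Longrightarrow> z \<in> set Zs \<Longrightarrow> f y z = g y z"
  shows "table_mat f Ys Zs = table_mat g Ys Zs"
  unfolding table_mat_def by (rule eq_matI) (use assms in auto)

lemma table_mat_map: "table_mat f (map \<phi> Ys) (map \<psi> Zs) = table_mat (\<lambda>y z. f (\<phi> y) (\<psi> z)) Ys Zs"
  unfolding table_mat_def by (rule eq_matI) auto

lemma table_mat_append: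
  "table_mat f (Ys @ Ys') (Zs @ Zs')
    = four_block_mat (table_mat f Ys Zs) (table_mat f Ys Zs') (table_mat f Ys' Zs) (table_mat f Ys' Zs')"
  unfolding table_mat_def by (rule eq_matI) (auto simp: nth_append)

lemma table_mat_zero: "table_mat (\<lambda>_ _. 0) Ys Zs = 0\<^sub>m (length Ys) (length Zs)"
  unfolding table_mat_def by (rule eq_matI) auto

lemma table_mat_add:
  "table_mat f Ys Zs + table_mat g Ys Zs = table_mat (\<lambda>y z. f y z + g y z) Ys Zs"
  unfolding table_mat_def by (rule eq_matI) auto

lemma table_mat_mult:
  fixes f :: "'x \<Rightarrow> 'y \<Rightarrow> 'r :: comm_ring_1"
  assumes "distinct Ys"
  shows "table_mat f Xs Ys * table_mat g Ys Zs = table_mat (\<lambda>x z. \<Sum>y\<in>set Ys. f x y * g y z) Xs Zs"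
proof (rule eq_matI)
  fix i j
  assume "i < dim_row (table_mat (\<lambda>x z. \<Sum>y\<in>set Ys. f x y * g y z) Xs Zs)"
    "j < dim_col (table_mat (\<lambda>x z. \<Sum>y\<in>set Ys. f x y * g y z) Xs Zs)"
  then have ij: "i < length Xs" "j < length Zs" by (auto simp: table_mat_def)
  have "(table_mat f Xs Ys * table_mat g Ys Zs) $$ (i, j)
    = (\<Sum>l = 0..<length Ys. f (Xs ! i) (Ys ! l) * g (Ys ! l) (Zs ! j))"
    by (subst mult_mat_index[OF table_mat_carrier table_mat_carrier ij]) (use ij in \<open>auto simp: table_mat_def\<close>)
  also have "\<dots> = (\<Sum>y\<in>set Ys. f (Xs ! i) y * g y (Zs ! j))"
    by (rule sum.reindex_bij_betw) (use bij_betw_nth[OF assms refl refl] in \<open>simp add: atLeast0LessThan\<close>)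
  finally show "(table_mat f Xs Ys * table_mat g Ys Zs) $$ (i, j)
    = table_mat (\<lambda>x z. \<Sum>y\<in>set Ys. f x y * g y z) Xs Zs $$ (i, j)"
    using ij by (simp add: table_mat_def)
qed (auto simp: table_mat_def)

lemma distinct_reordering:
  assumes "distinct xs" "distinct ys" "set xs = set ys"
  obtains h where "bij_betw h {..<length xs} {..<length xs}" "\<And>i. i < length xs \<Longrightarrow> xs ! h i = ys ! i"
proof -
  have len: "length ys = length xs" using assms distinct_card by metis
  have x: "bij_betw ((!) xs) {..<length xs} (set xs)" by (rule bij_betw_nth[OF assms(1) refl refl])
  have y: "bij_betw ((!) ys) {..<length xs} (set xs)"
    using bij_betw_nth[OF assms(2) refl refl] assms(3) len by simp
  define h where "h = the_inv_into {..<length xs} ((!) xs) \<circ> (!) ys"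
  have "bij_betw h {..<length xs} {..<length xs}"
    unfolding h_def by (rule bij_betw_trans[OF y bij_betw_the_inv_into[OF x]])
  moreover have "xs ! h i = ys ! i" if "i < length xs" for i
    unfolding h_def comp_def using that len assms(3)
    by (intro f_the_inv_into_f_bij_betw[OF x]) auto
  ultimately show thesis by (rule that)
qed

lemma mat_equiv_table_mat:
  fixes f :: "'y \<Rightarrow> 'z \<Rightarrow> 'r :: comm_ring_1"
  assumes "distinct Ys" "distinct Ys'" "set Ys = set Ys'" "distinct Zs" "distinct Zs'" "set Zs = set Zs'"
  shows "mat_equiv (table_mat f Ys Zs) (table_mat f Ys' Zs')"
proof -
  obtain g where g: "bij_betw g {..<length Ys} {..<length Ys}" "\<And>i. i < length Ys \<Longrightarrow> Ys ! g i = Ys' ! i"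
    using distinct_reordering[OF assms(1-3)] by metis
  obtain h where h: "bij_betw h {..<length Zs} {..<length Zs}" "\<And>i. i < length Zs \<Longrightarrow> Zs ! h i = Zs' ! i"
    using distinct_reordering[OF assms(4-6)] by metis
  have len: "length Ys' = length Ys" "length Zs' = length Zs" using assms distinct_card by metis+
  have "g i < length Ys" if "i < length Ys" for i using that g(1) by (auto dest: bij_betwE)
  moreover have "h i < length Zs" if "i < length Zs" for i using that h(1) by (auto dest: bij_betwE)
  ultimately have "mat (length Ys) (length Zs) (\<lambda>(i, j). table_mat f Ys Zs $$ (g i, h j)) = table_mat f Ys' Zs'"
    by (intro eq_matI) (auto simp: table_mat_def len g(2) h(2))
  with mat_equiv_reindex[OF table_mat_carrier g(1) h(1), of f] show ?thesis by simp
qed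

text \<open>Cones over flats come first and subspaces at infinity second, giving the triangular
  block shape; \<open>flat_line_identity\<close>, read entrywise, then removes the upper right
  block.\<close>

lemma mat_equiv_incidence_blocks:
  fixes Ys Ys' Zs' Vs Ls :: "'q :: {field, finite} vec set list" and u' :: "'r :: comm_ring_1"
  assumes r: "r + 2 \<le> n" and u': "of_nat (\<Sum>i<n - r - 1. CARD('q) ^ i) * u' = 1"
    and Ys: "distinct Ys" "set Ys = flats n r"
    and Zs: "distinct Zs" "set Zs = carrier_vec n"
    and Ys': "distinct Ys'" "set Ys' = subspaces n (Suc r)"
    and Zs': "distinct Zs'" "set Zs' = subspaces n 1"
    and Vs: "distinct Vs" "set Vs = subspaces (Suc n) (Suc r)"
    and Ls: "distinct Ls" "set Ls = subspaces (Suc n) 1"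
  shows "mat_equiv (incidence_mat (\<lambda>Y Z. Z \<subseteq> Y) Vs Ls)
    (four_block_mat (incidence_mat (\<lambda>Y Z. Z \<in> Y) Ys Zs) (0\<^sub>m (length Ys) (length Zs'))
      (0\<^sub>m (length Ys') (length Zs)) (incidence_mat (\<lambda>Y Z. Z \<subseteq> Y) Ys' Zs') :: 'r mat)"
proof -
  let ?inf = "(`) (vCons 0) :: 'q vec set \<Rightarrow> 'q vec set" and ?pt = "\<lambda>z :: 'q vec. cone {z}"
  let ?A = "table_mat (\<lambda>Y Z. of_bool (Z \<in> Y)) Ys Zs :: 'r mat"
  let ?D = "table_mat (\<lambda>Y Z. of_bool (Z \<subseteq> Y)) Ys' Zs' :: 'r mat"
  let ?B = "table_mat (\<lambda>Y Z. of_bool (Z \<subseteq> direction Y)) Ys Zs' :: 'r mat"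
  let ?f = "\<lambda>Y Z :: 'q vec set. of_bool (Z \<subseteq> Y) :: 'r"
  have inf_inj: "inj ?inf" by (auto simp: inj_on_def infinity_subset_iff set_eq_subset)
  have pt_inj: "inj_on ?pt (carrier_vec n)"
  proof (rule inj_onI)
    fix z z' :: "'q vec" assume *: "z \<in> carrier_vec n" "z' \<in> carrier_vec n" "cone {z} = cone {z'}"
    have "{z} = {z'}"
      using inj_onD[OF inj_on_cone *(3) point_in_flats[OF *(1)] point_in_flats[OF *(2)]] .
    then show "z = z'" by simp
  qed
  have reorder: "mat_equiv (table_mat ?f Vs Ls) (table_mat ?f (map cone Ys @ map ?inf Ys') (map ?pt Zs @ map ?inf Zs'))"
  proof (rule mat_equiv_table_mat[OF Vs(1) _ _ Ls(1)])
    show "distinct (map cone Ys @ map ?inf Ys')"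
      using Ys Ys' inj_on_cone[of n r, where ?'q = 'q] inf_inj cone_neq_infinity[of _ n r, where ?'q = 'q]
      by (auto simp: distinct_map intro: inj_on_subset)
    show "distinct (map ?pt Zs @ map ?inf Zs')"
      using Zs Zs' pt_inj inf_inj cone_neq_infinity[OF point_in_flats, where ?'q = 'q]
      by (auto simp: distinct_map intro: inj_on_subset)
    show "set Vs = set (map cone Ys @ map ?inf Ys')" using Vs Ys Ys' subspaces_Suc_eq[of n r] by simp
    show "set Ls = set (map ?pt Zs @ map ?inf Zs')"
      using Ls Zs Zs' subspaces_Suc_eq[of n 0, where ?'q = 'q] by (simp add: flats_0 image_image)
  qed
  have blocks: "table_mat ?f (map cone Ys @ map ?inf Ys') (map ?pt Zs @ map ?inf Zs')
    = four_block_mat ?A ?B (0\<^sub>m (length Ys') (length Zs)) ?D"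
    unfolding table_mat_append table_mat_map
  proof (rule cong_four_block_mat)
    show "table_mat (\<lambda>y z. ?f (cone y) (?pt z)) Ys Zs = ?A"
      by (rule table_mat_cong)
        (use Ys Zs in \<open>simp add: point_cone_subset_iff[OF _ subspaces_linear_set[OF cone_subspaces]] vCons_1_mem_cone_iff\<close>)
    show "table_mat (\<lambda>y z. ?f (cone y) (?inf z)) Ys Zs' = ?B"
    proof (rule table_mat_cong)
      fix Y Z assume "Y \<in> set Ys" "Z \<in> set Zs'"
      then have "Y \<in> flats n r" "Z \<subseteq> carrier_vec n"
        using Ys Zs' linear_set_carrier[OF subspaces_linear_set] by blast+
      then show "?f (cone Y) (?inf Z) = of_bool (Z \<subseteq> direction Y)"
        by (simp add: infinity_subset_cone_iff)
    qed
    have "\<not> ?pt z \<subseteq> ?inf Y" if "Y \<in> set Ys'" "z \<in> set Zs" for Y z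
      using point_cone_subset_iff[OF _ linear_set_infinity[OF subspaces_linear_set], of z n Y "Suc r"] that Ys' Zs
      by (simp add: vCons_mem_infinity_iff)
    then have "table_mat (\<lambda>y z. ?f (?inf y) (?pt z)) Ys' Zs = table_mat (\<lambda>_ _. 0) Ys' Zs"
      by (intro table_mat_cong) simp
    then show "table_mat (\<lambda>y z. ?f (?inf y) (?pt z)) Ys' Zs = 0\<^sub>m (length Ys') (length Zs)"
      unfolding table_mat_zero .
    show "table_mat (\<lambda>y z. ?f (?inf y) (?inf z)) Ys' Zs' = ?D"
      by (rule table_mat_cong) (simp add: infinity_subset_iff)
  qed
  have split: "mat_equiv (four_block_mat ?A ?B (0\<^sub>m (length Ys') (length Zs)) ?D)
    (four_block_mat ?A (0\<^sub>m (length Ys) (length Zs')) (0\<^sub>m (length Ys') (length Zs)) ?D)"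
  proof -
    \<comment> \<open>Row \<open>F\<close> of \<open>?A\<close> times column \<open>L\<close> of
      \<open>X\<close> gives \<open>1 - u'\<close> if \<open>F\<close> contains the origin and
      \<open>0\<close> otherwise, minus the number of points common to \<open>F\<close> and
      \<open>L\<close>.\<close>
    define X where "X = table_mat (\<lambda>z L. of_bool (z = 0\<^sub>v n) * (1 - u') - of_bool (z \<in> L)) Zs Zs'"
    \<comment> \<open>Row \<open>F\<close> of \<open>T\<close> times column \<open>L\<close> of
      \<open>?D\<close> is the weighted number of \<open>(r+1)\<close>-dimensional subspaces
      containing both.\<close>
    define T where "T = table_mat (\<lambda>F Y. (if 0\<^sub>v n \<in> F then u' else 1) * of_bool (F \<subseteq> Y)) Ys Ys'"
    have XT: "X \<in> carrier_mat (length Zs) (length Zs')" "T \<in> carrier_mat (length Ys) (length Ys')"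
      by (simp_all add: X_def T_def)
    have eqB: "?A * X + T * ?D = ?B"
      unfolding X_def T_def table_mat_mult[OF Zs(1)] table_mat_mult[OF Ys'(1)] table_mat_add
    proof (rule table_mat_cong)
      fix F L assume "F \<in> set Ys" "L \<in> set Zs'"
      then have F: "F \<in> flats n r" and L: "L \<in> subspaces n 1" using Ys Zs' by auto
      have fin: "finite (carrier_vec n :: 'q vec set)" by (rule finite_carrier_vec)
      have "(\<Sum>z\<in>carrier_vec n. of_bool (z \<in> F) * (of_bool (z = 0\<^sub>v n) * (1 - u')))
        = (\<Sum>z\<in>carrier_vec n. if z = (0\<^sub>v n :: 'q vec) then of_bool (0\<^sub>v n \<in> F) * (1 - u') else 0)"
        by (rule sum.cong) auto
      then have 1: "(\<Sum>z\<in>carrier_vec n. of_bool (z \<in> F) * (of_bool (z = 0\<^sub>v n) * (1 - u'))) = (if 0\<^sub>v n \<in> F then 1 - u' else 0)"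
        by (simp add: finite_carrier_vec)
      have "(\<Sum>z\<in>carrier_vec n. of_bool (z \<in> F) * of_bool (z \<in> L)) = (\<Sum>z\<in>carrier_vec n. of_bool (z \<in> F \<inter> L) :: 'r)"
        by (rule sum.cong) auto
      also have "\<dots> = of_nat (card (carrier_vec n \<inter> {z. z \<in> F \<inter> L}))"
        by (intro sum_of_bool_eq fin)
      also have "carrier_vec n \<inter> {z. z \<in> F \<inter> L} = F \<inter> L" using flat_subset[OF F] by blast
      finally have 2: "(\<Sum>z\<in>carrier_vec n. of_bool (z \<in> F) * of_bool (z \<in> L)) = (of_nat (card (F \<inter> L)) :: 'r)" .
      have "(\<Sum>Y\<in>subspaces n (Suc r). (if 0\<^sub>v n \<in> F then u' else 1) * of_bool (F \<subseteq> Y) * of_bool (L \<subseteq> Y))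
        = (if 0\<^sub>v n \<in> F then u' else 1) * (\<Sum>Y\<in>subspaces n (Suc r). of_bool (F \<subseteq> Y \<and> L \<subseteq> Y))"
        unfolding sum_distrib_left by (rule sum.cong) auto
      also have "(\<Sum>Y\<in>subspaces n (Suc r). of_bool (F \<subseteq> Y \<and> L \<subseteq> Y)) = (of_nat (card (subspaces n (Suc r) \<inter> {Y. F \<subseteq> Y \<and> L \<subseteq> Y})) :: 'r)"
        by (intro sum_of_bool_eq finite_subspaces)
      also have "subspaces n (Suc r) \<inter> {Y. F \<subseteq> Y \<and> L \<subseteq> Y} = {Y \<in> subspaces n (Suc r). F \<subseteq> Y \<and> L \<subseteq> Y}"
        by blast
      finally have 3: "(\<Sum>Y\<in>subspaces n (Suc r). (if 0\<^sub>v n \<in> F then u' else 1) * of_bool (F \<subseteq> Y) * of_bool (L \<subseteq> Y))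
        = (if 0\<^sub>v n \<in> F then u' else 1) * of_nat (card {Y \<in> subspaces n (Suc r). F \<subseteq> Y \<and> L \<subseteq> Y})" .
      show "(\<Sum>z\<in>set Zs. of_bool (z \<in> F) * (of_bool (z = 0\<^sub>v n) * (1 - u') - of_bool (z \<in> L)))
          + (\<Sum>Y\<in>set Ys'. (if 0\<^sub>v n \<in> F then u' else 1) * of_bool (F \<subseteq> Y) * of_bool (L \<subseteq> Y))
        = of_bool (L \<subseteq> direction F)"
        unfolding Zs(2) Ys'(2) right_diff_distrib[of _ _ "of_bool _"] sum_subtractf 1 2 3 flat_line_identity[OF F L r u']
        by (simp add: of_bool_def)
    qed
    \<comment> \<open>\<open>?B\<close> is created from zero rather than cleared: the column
      operation contributes \<open>?A * X\<close> and the row operation \<open>T * ?D\<close>.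
      Symmetry then reverses both.\<close>
    have e1: "mat_equiv (four_block_mat ?A (0\<^sub>m (length Ys) (length Zs')) (0\<^sub>m (length Ys') (length Zs)) ?D)
      (four_block_mat ?A (?A * X) (0\<^sub>m (length Ys') (length Zs)) ?D)"
      using mat_equiv_col_op[OF table_mat_carrier zero_carrier_mat zero_carrier_mat table_mat_carrier XT(1)] XT
      by (simp add: right_add_zero_mat[of _ "length Ys" "length Zs'"] left_add_zero_mat[of _ "length Ys'" "length Zs'"]
        left_mult_zero_mat[of X "length Zs"] mult_carrier_mat[of _ _ "length Zs"])
    have e2: "mat_equiv (four_block_mat ?A (?A * X) (0\<^sub>m (length Ys') (length Zs)) ?D)
      (four_block_mat ?A (?A * X + T * ?D) (0\<^sub>m (length Ys') (length Zs)) ?D)"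
      using mat_equiv_row_op[OF table_mat_carrier mult_carrier_mat[OF table_mat_carrier XT(1)] zero_carrier_mat table_mat_carrier XT(2)] XT
      by (simp add: right_mult_zero_mat[of T _ "length Ys'"] right_add_zero_mat[of _ "length Ys" "length Zs"])
    show ?thesis by (rule mat_equiv_sym[OF mat_equiv_trans[OF e1 e2[unfolded eqB]]])
  qed
  show ?thesis
    unfolding incidence_mat_eq_table_mat
    by (rule mat_equiv_trans[OF reorder[unfolded blocks] split])
qed

text \<open>Row \<open>z\<close> of \<open>C\<close> lists the coefficients that express
  \<open>q^r\<close> times the indicator of \<open>z\<close> through \<open>r\<close>-flats.\<close>

lemma flat_incidence_left_quasi_inverse:
  fixes Ys :: "'q :: {field, finite} vec set list"
  assumes r: "r < n" and Ys: "distinct Ys" "set Ys = flats n r"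
    and Zs: "distinct Zs" "set Zs = carrier_vec n"
  obtains C :: "'r :: comm_ring_1 mat" where "C \<in> carrier_mat (length Zs) (length Ys)"
    "C * incidence_mat (\<lambda>Y Z. Z \<in> Y) Ys Zs = of_nat CARD('q) ^ r \<cdot>\<^sub>m 1\<^sub>m (length Zs)"
proof -
  have "\<exists>c :: 'q vec set \<Rightarrow> 'r. \<forall>x\<in>carrier_vec n. of_nat CARD('q) ^ r * of_bool (x = z) = (\<Sum>G\<in>flats n r. c G * of_bool (x \<in> G))"
    if "z \<in> carrier_vec n" for z
    using flat_span_lower_flat[OF r order_refl, of "{z}", where ?'r = 'r] point_in_flats[OF that]
    by (simp add: flat_span_def)
  then obtain c :: "'q vec \<Rightarrow> 'q vec set \<Rightarrow> 'r" where c: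
    "\<And>z x. z \<in> carrier_vec n \<Longrightarrow> x \<in> carrier_vec n \<Longrightarrow>
      of_nat CARD('q) ^ r * of_bool (x = z) = (\<Sum>G\<in>flats n r. c z G * of_bool (x \<in> G))"
    by metis
  have "table_mat c Zs Ys * incidence_mat (\<lambda>Y Z. Z \<in> Y) Ys Zs = table_mat (\<lambda>z x. of_nat CARD('q) ^ r * of_bool (x = z)) Zs Zs"
    unfolding incidence_mat_eq_table_mat table_mat_mult[OF Ys(1)]
    by (rule table_mat_cong) (use c Ys Zs in simp)
  also have "\<dots> = of_nat CARD('q) ^ r \<cdot>\<^sub>m 1\<^sub>m (length Zs)"
    by (rule eq_matI) (use Zs in \<open>auto simp: table_mat_def nth_eq_iff_index_eq\<close>)
  finally show thesis using that table_mat_carrier by blast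
qed

section \<open>Conclusion over the \<open>p\<close>-adic integers\<close>

lemma uniformizer_padic: "uniformizer (of_nat CARD('p) :: 'p :: prime_card padic_int)"
  by unfold_locales (use padic_p_not_unit padic_p_power_nonzero padic_decompose in auto)

context uniformizer
begin

lemma unit_one_plus: "1 + \<pi> * c dvd 1"
proof (rule not_dvd_imp_unit)
  show "\<not> \<pi> dvd 1 + \<pi> * c" using not_unit by (simp add: dvd_add_left_iff)
qed

text \<open>The sum is \<open>1\<close> modulo \<pi> as soon as it has its first term; the empty sum
  would be \<open>0\<close>.\<close>

lemma geometric_sum_unit:
  assumes "\<pi> dvd x" "0 < k"
  shows "(\<Sum>i<k. x ^ i) dvd 1"
proof -
  obtain y where "x = \<pi> * y" using assms(1) by blast
  moreover obtain l where "k = Suc l" using assms(2) by (cases k) auto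
  ultimately have "(\<Sum>i<k. x ^ i) = 1 + \<pi> * (y * (\<Sum>i<l. x ^ i))"
    by (simp add: sum.lessThan_Suc_shift sum_distrib_left mult.assoc del: sum.lessThan_Suc)
  then show ?thesis using unit_one_plus by simp
qed

end

lemma exists_distinct_list: "finite S \<Longrightarrow> distinct (SOME xs. distinct xs \<and> set xs = S) \<and> set (SOME xs. distinct xs \<and> set xs = S) = S"
  by (rule someI_ex) (use finite_distinct_list in blast)

theorem theorem8p2:
  fixes p t n r :: nat
    and Ys :: "'q :: {field, finite} vec set list"
    and Zs :: "'q vec list"
    and A\<^sub>1 :: "'p :: prime_card padic_int mat"
  assumes "p = CARD('p)"
    and "CARD('q) = p ^ t"
    and "n \<ge> 3"
    and "1 \<le> r" and "r \<le> n - 2"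
    and "distinct Ys" and "set Ys = flats n r"
    and "distinct Zs" and "set Zs = carrier_vec n"
    and "A\<^sub>1 = incidence_mat (\<lambda>Y Z. Z \<in> Y) Ys Zs"
  shows "(\<forall>d \<in> set (invariant_factors A\<^sub>1). \<exists>\<alpha> \<le> r * t. eq_up_to_unit d (of_nat p ^ \<alpha>)) \<and>
         (\<forall>\<alpha> \<le> r * t.
            int (invariant_factor_mult (of_nat p ^ \<alpha>) A\<^sub>1) =
              int (proj_mult TYPE('p) TYPE('q) \<alpha> n (r + 1)) -
              int (proj_mult TYPE('p) TYPE('q) \<alpha> (n - 1) (r + 1)))"
proof -
  let ?p = "of_nat CARD('p) :: 'p padic_int"
  interpret uniformizer ?p by (rule uniformizer_padic)
  have r: "r + 2 \<le> n" "r < n" using assms by auto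
  have q: "of_nat CARD('q) = ?p ^ t" using assms(1,2) by simp
  have A: "A\<^sub>1 \<in> carrier_mat (length Ys) (length Zs)"
    using assms(10) by (simp add: incidence_mat_def)
  obtain C :: "'p padic_int mat" where C: "C \<in> carrier_mat (length Zs) (length Ys)"
    "C * A\<^sub>1 = of_nat CARD('q) ^ r \<cdot>\<^sub>m 1\<^sub>m (length Zs)"
    using flat_incidence_left_quasi_inverse[OF r(2) assms(6-9)] assms(10) by metis
  then have "C * A\<^sub>1 = ?p ^ (r * t) \<cdot>\<^sub>m 1\<^sub>m (length Zs)"
    by (simp add: q power_mult[symmetric] mult.commute)
  from invariant_factor_dvd_power[OF A C(1) this]
  have bound: "\<forall>d \<in> set (invariant_factors A\<^sub>1). \<exists>\<alpha> \<le> r * t. eq_up_to_unit d (?p ^ \<alpha>)" by blast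
  \<comment> \<open>A field has more than one element, so \<open>q\<close> is a proper power and is
    divisible by \<open>p\<close>.\<close>
  have "t \<noteq> 0" using assms(2) CARD_field_gt_1[where ?'q = 'q] by (intro notI) simp
  then have "?p dvd of_nat CARD('q)" unfolding q by (simp add: dvd_power)
  then have "(\<Sum>i<n - r - 1. of_nat CARD('q) ^ i) dvd (1 :: 'p padic_int)"
    by (rule geometric_sum_unit) (use r in simp)
  then obtain u' :: "'p padic_int" where u': "of_nat (\<Sum>i<n - r - 1. CARD('q) ^ i) * u' = 1"
    by (auto simp: dvd_def)
  let ?list = "\<lambda>S :: 'q vec set set. SOME xs. distinct xs \<and> set xs = S"
  have list: "distinct (?list (subspaces d k))" "set (?list (subspaces d k)) = subspaces d k" for d k
    using exists_distinct_list[OF finite_subspaces] by auto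
  let ?D = "incidence_mat (\<lambda>Y Z. Z \<subseteq> Y) (?list (subspaces n (Suc r))) (?list (subspaces n 1)) :: 'p padic_int mat"
  have D: "?D \<in> carrier_mat (length (?list (subspaces n (Suc r)))) (length (?list (subspaces n 1)))"
    by (simp add: incidence_mat_def)
  have equiv: "mat_equiv (incidence_mat (\<lambda>Y Z. Z \<subseteq> Y) (?list (subspaces (Suc n) (Suc r))) (?list (subspaces (Suc n) 1)))
    (four_block_mat A\<^sub>1 (0\<^sub>m (length Ys) (length (?list (subspaces n 1))))
      (0\<^sub>m (length (?list (subspaces n (Suc r)))) (length Zs)) ?D)"
    unfolding assms(10)
    by (rule mat_equiv_incidence_blocks[OF r(1) u' assms(6-9) list list list list])
  \<comment> \<open>The hyperplane at infinity is \<open>PG(n-1, q)\<close>, whose subspaces live in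
    vectors of length \<open>n - 1 + 1\<close>.\<close>
  have "n - 1 + 1 = n" using assms(3) by simp
  then have "proj_mult TYPE('p) TYPE('q) \<alpha> n (r + 1)
    = invariant_factor_mult (?p ^ \<alpha>) A\<^sub>1 + proj_mult TYPE('p) TYPE('q) \<alpha> (n - 1) (r + 1)" for \<alpha>
    using invariant_factor_mult_block_diag[OF A D equiv, of \<alpha>]
    by (simp add: proj_mult_def)
  then show ?thesis using bound assms(1) by simp
qed

end
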